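(* Let $(k,r)$ be arbitrary, $k\ge1$ and $r\ge 3$ integers, with $\gcd(k,\gamma)=1$, $\gamma=r-2$, and let $\epsilon\in\{0,1\}$. Let $(S_l)_{l\in\mathbb Z}$, $S_l=(s_{l,i,j})$, be the fine Stokes matrices of a $k\times k$ system of the type described in the context, and let $\theta_n^{(A)}$ $(0\le n\le k)$ be the associated theta parameters. Let $a\in\{0,1,\dots,r-1\}$, and let $X^{(l)}=(x^{(l)}_1,\dots,x^{(l)}_k)^{T}\in\mathbb C^k$ $(l\in\mathbb Z)$ be the coefficient vectors of a solution of the system, so that $X^{(l)}=S_lX^{(l+1)}$ (in particular $X^{(2rn)}=S_{2rn}S_{2rn+1}\cdots S_{2r(n+1)-1}\,X^{(2r(n+1))}$). Suppose this solution satisfies the multi-cut $2a$ boundary condition. Then the numbers $y_n^{(2s)}$ (the dominant components of the solution, defined in the context) satisfy the recursion equations $$\mathcal F_b^{(2s)}\bigl[\{y_n^{(2s)}\}_{n\in\mathbb Z}\bigr]\equiv\sum_{\substack{n\in\mathbb Z\\ 0\le r(n-1)+b\le k}}\theta^{(2r(n-1)+2s)}_{r(n-1)+b}\;y_n^{(2s)}=0$$ for all $$s=rq+a+\epsilon\,\frac r2,\qquad 0\le q\le k-1,\qquad 1\le b\le r .$$ Moreover all the $y_n^{(2s)}$ are non-zero and satisfy $$y_n^{(2s)}=y_{n-c}^{(2s+2rc)},\qquad y_n^{(2s)}=y_{n+k}^{(2s)}\qquad(n,c\in\mathbb Z).$$ Therefore there are $r$ distinct sequences $\{y_n^{(2a+\epsilon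 r)}\}_{n=1}^{k}$, $a=0,1,\dots,r-1$, one corresponding to each boundary condition $2a$.
   Context: **The system.** Let $\omega=e^{2\pi i/k}$ and $\Omega=\mathrm{diag}(1,\omega,\dots,\omega^{k-1})$. Consider the linear ODE $g\,\partial_\zeta\widetilde\Psi=\widetilde{\mathcal Q}(\zeta)\widetilde\Psi$, where $g>0$ and $\widetilde{\mathcal Q}$ is a $k\times k$ matrix polynomial of degree $r-1$ in $\zeta$ with leading term $(\omega^{\epsilon/2}\Omega)^{-\gamma}\zeta^{r-1}$, so that $\zeta=\infty$ is an irregular singularity of Poincaré index $r$. (This is, in a diagonalizing basis, the ODE system of the fractional-superstring critical point $(\hat p,\hat q)=(1,r-1)$ of the $k$-cut two-matrix model. The case $\epsilon=0$ is the "$\omega^{1/2}$-rotated" model and $\epsilon=1$ the "real-potential" model.) There is a formal solution $$\widetilde\Psi_{asym}=\bigl(I_k+O(\zeta^{-1})\bigr)\exp\bigl[g^{-1}\mathrm{diag}_j(\varphi^{(j)}(\zeta))\bigr],\qquad \varphi^{(j)}(\zeta)=\tfrac1r\varphi^{(j)}_{-r}\zeta^r+\cdots,\qquad \varphi^{(j)}_{-r}=\omega^{-\gamma(j-1+\epsilon/2)}.$$ Indices $j$ labelling components are taken modulo $k$ in $\{1,\dots,k\}$. **Segments, sectors, Stokes matrices.** For $l\in\mathbb Z$: - The segment $\delta D_l$ is $\{\pi(l-1)/(kr)<\arg\zeta<\pi l/(kr)\}$. - The fine Stokes sector $D_l$ is $\{\pi(l-1)/(kr)<\arg\zeta<\pi(l+k)/(kr)\}$.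 It contains the $k+1$ segments $\delta D_l,\dots,\delta D_{l+k}$. - $\widetilde\Psi_l$ is the unique (canonical) solution with $\widetilde\Psi_l\simeq\widetilde\Psi_{asym}$ as $\zeta\to\infty$ in $D_l$. - The Stokes matrices are defined by $\widetilde\Psi_{l+1}=\widetilde\Psi_lS_l$. Indices $l$ are periodic modulo $2rk$, $S_{l+2rk}=S_l$, and the monodromy-free condition $S_0S_1\cdots S_{2rk-1}=I_k$ holds. **Profile.** For each $l$, the numbers $j_{l,1},\dots,j_{l,k}$ are the permutation of $1,\dots,k$ with $$\mathrm{Re}[\varphi^{(j_{l,1})}_{-r}\zeta^r]<\cdots<\mathrm{Re}[\varphi^{(j_{l,k})}_{-r}\zeta^r]\qquad\text{for }\zeta\in\delta D_l.$$ Label $i$ is called more dominant than label $j$ in segment $l$ if $i$ stands to the right of $j$ in this list. Let $m_1$ be an integer with $\gamma m_1\equiv1\pmod k$. Then, modulo $k$, $$j_{l,n}= 1+\Bigl(\bigl\lfloor\tfrac{l-\epsilon\gamma}{2}\bigr\rfloor+(-1)^{k+(l-\epsilon\gamma)+n}\bigl\lfloor\tfrac{k-n+1}{2}\bigr\rfloor\Bigr)m_1 .$$ One writes $(j|i)_l\in J_l$ if $j=j_{l,n}$ and $i=j_{l,n+1}$ are adjacent in row $l$ and are interchanged in row $l+1$. The Stokes matrices satisfy $s_{l,i,i}=1$, and for $i\ne j$ one has $s_{l,i,j}=0$ unless $(j|i)_l\in J_l$. **Theta parameters.** For $A\in\epsilon r+2\mathbb Z$ (taken modulo $2rk$) and $1\le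 n\le k-1$, $$\theta_n^{(A)}=s_{L,\;j_{L,k-n+1},\;j_{L,k-n}},\qquad L=2r+A-n,$$ and $\theta^{(A)}_0=-1$, $\theta^{(A)}_k=+1$. **Coefficient vectors.** A vector solution $\Psi$ of the ODE is written $\Psi=\widetilde\Psi_lX^{(l)}$ with $X^{(l)}\in\mathbb C^k$ for every $l$. Hence $X^{(l)}=S_lX^{(l+1)}$ and $X^{(l+2rk)}=X^{(l)}$. **Multi-cut $2a$ boundary condition.** This requires that the dominant term in the asymptotics of $\Psi$ as $\zeta\to\infty$ changes (there is a "physical cut") exactly along the $k$ directions $\arg\zeta=\frac{\pi}{k}(1-\epsilon)+\frac{2\pi a}{rk}+\frac{2\pi n}{k}$, $n=0,\dots,k-1$, with the following pattern of dominant components. Put $s_0=a+\epsilon r/2$ and, for $N\in\mathbb Z$, $c_N\equiv1+(rN+s_0-\epsilon\gamma/2)m_1 \pmod k$. For every $N\in\mathbb Z$, every segment index $p$ with $2rN+2s_0-r+1\le p\le 2rN+2s_0+r$, and every $l$ with $l\le p\le l+k$: - $x^{(l)}_{c_N}\neq0$; - $x^{(l)}_j=0$ for every label $j$ that is more dominant than $c_N$ in segment $p$. The case $a=0$ is the multi-cut boundary condition itself. The cases $a=1,\dots,r-1$ are the "complementary" boundary conditions. **The sequences $y$.** For a solution satisfying the $2a$ boundary condition, and for $s=rq+a+\epsilon r/2$ with $q\in\mathbb Z$, $$y_n^{(2s)}=x^{(2rn+2s)}_{\,1+(rn+s-\epsilon\gamma/2)m_1}\qquad(n\in\mathbb Z),$$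 with the lower index taken modulo $k$.
   Formalization: The pairs (k,r) with 2k<r and 0 < r mod 2k < k are excluded: there the equation for b=k reads y_1=0, contradicting that all y_n are non-zero, while the boundary condition can be satisfied (for example k=2, r=5). *)

theory Defs
  imports
    Complex_Main
    "HOL-Library.Landau_Symbols"
    "HOL-Computational_Algebra.Polynomial"
    "HOL-Computational_Algebra.Formal_Power_Series"
    "HOL-Number_Theory.Cong"
    "Jordan_Normal_Form.Matrix"
begin

text \<open>
  Throughout, \<open>eps\<close> is 0 or 1 and \<open>\<gamma> = r - 2\<close>. Component labels are integers, read modulo \<open>k\<close> with
  representatives \<open>1, \<dots>, k\<close>; label \<open>j\<close> is position \<open>(j - 1) mod k\<close> of the 0-based matrices and
  vectors of the library.
\<close>

definition wrap :: "nat \<Rightarrow> int \<Rightarrow> int" where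
  "wrap k j = (j - 1) mod int k + 1"

definition entry :: "nat \<Rightarrow> complex mat \<Rightarrow> int \<Rightarrow> int \<Rightarrow> complex" where
  "entry k M i j = M $$ (nat ((i - 1) mod int k), nat ((j - 1) mod int k))"

definition component :: "nat \<Rightarrow> complex vec \<Rightarrow> int \<Rightarrow> complex" where
  "component k v j = vec_index v (nat ((j - 1) mod int k))"

section \<open>The linear system and its formal solution\<close>

text \<open>\<open>\<phi>\<^sup>(\<^sup>j\<^sup>)\<^sub>-\<^sub>r = \<omega> ^ (- \<gamma> (j - 1 + eps / 2))\<close> with \<open>\<omega> = exp (2 \<pi> \<i> / k)\<close>; this is also the \<open>j\<close>-th
  diagonal entry of the leading coefficient \<open>(\<omega> ^ (eps / 2) \<Omega>) ^ (- \<gamma>)\<close> of the system.\<close>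

definition phi_lead :: "nat \<Rightarrow> nat \<Rightarrow> nat \<Rightarrow> int \<Rightarrow> complex" where
  "phi_lead k r eps j =
     cis (- (2 * pi / real k) * (real r - 2) * (of_int (j - 1) + real eps / 2))"

definition system_matrix :: "nat \<Rightarrow> nat \<Rightarrow> nat \<Rightarrow> complex poly mat \<Rightarrow> bool" where
  "system_matrix k r eps Q \<longleftrightarrow>
     Q \<in> carrier_mat k k \<and>
     (\<forall>i<k. \<forall>j<k. degree (Q $$ (i, j)) \<le> r - 1 \<and>
        coeff (Q $$ (i, j)) (r - 1) = (if i = j then phi_lead k r eps (int j + 1) else 0))"

definition eval_mat :: "complex poly mat \<Rightarrow> complex \<Rightarrow> complex mat" where
  "eval_mat Q z = map_mat (\<lambda>p. poly p z) Q"

definition matrix_solution ::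
    "nat \<Rightarrow> real \<Rightarrow> complex poly mat \<Rightarrow> (complex \<Rightarrow> complex mat) \<Rightarrow> bool" where
  "matrix_solution k g Q \<Psi> \<longleftrightarrow>
     (\<forall>z. \<Psi> z \<in> carrier_mat k k) \<and>
     (\<forall>z. \<forall>i<k. \<forall>j<k. ((\<lambda>w. \<Psi> w $$ (i, j)) has_field_derivative
        (eval_mat Q z * \<Psi> z) $$ (i, j) / of_real g) (at z))"

definition vector_solution ::
    "nat \<Rightarrow> real \<Rightarrow> complex poly mat \<Rightarrow> (complex \<Rightarrow> complex vec) \<Rightarrow> bool" where
  "vector_solution k g Q \<psi> \<longleftrightarrow>
     (\<forall>z. \<psi> z \<in> carrier_vec k) \<and>
     (\<forall>z. \<forall>i<k. ((\<lambda>w. vec_index (\<psi> w) i) has_field_derivative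
        vec_index (eval_mat Q z *\<^sub>v \<psi> z) i / of_real g) (at z))"

text \<open>\<open>phi j\<close> is a polynomial without a logarithmic term: the formal monodromy at infinity is trivial.\<close>

definition exponents :: "nat \<Rightarrow> nat \<Rightarrow> nat \<Rightarrow> (int \<Rightarrow> complex poly) \<Rightarrow> bool" where
  "exponents k r eps phi \<longleftrightarrow>
     (\<forall>j\<in>{1..int k}. degree (phi j) = r \<and> coeff (phi j) r = phi_lead k r eps j / of_nat r)"

text \<open>The polynomial \<open>u ^ d * p (1 / u)\<close>, for \<open>degree p \<le> d\<close>, as a power series in \<open>u = 1 / \<zeta>\<close>.\<close>

definition at_inf :: "nat \<Rightarrow> complex poly \<Rightarrow> complex fps" where
  "at_inf d p = Abs_fps (\<lambda>n. if n \<le> d then coeff p (d - n) else 0)"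

text \<open>
  \<open>Y = I + O(1 / \<zeta>)\<close>, a matrix of power series in \<open>u = 1 / \<zeta>\<close>, such that
  \<open>Y exp (g\<^sup>-\<^sup>1 diag phi)\<close> formally solves the system. The equation
  \<open>g \<partial>\<^sub>\<zeta> Y + Y diag (\<partial>\<^sub>\<zeta> phi) = Q Y\<close> is multiplied by \<open>u ^ (r - 1)\<close>, using
  \<open>\<partial>\<^sub>\<zeta> = - u\<^sup>2 \<partial>\<^sub>u\<close>.
\<close>

definition formal_solution ::
    "nat \<Rightarrow> nat \<Rightarrow> real \<Rightarrow> complex poly mat \<Rightarrow> (int \<Rightarrow> complex poly) \<Rightarrow> complex fps mat \<Rightarrow> bool" where
  "formal_solution k r g Q phi Y \<longleftrightarrow>
     Y \<in> carrier_mat k k \<and>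
     (\<forall>i<k. \<forall>j<k.
        fps_nth (Y $$ (i, j)) 0 = (if i = j then 1 else 0) \<and>
        - fps_const (of_real g) * fps_X ^ (r + 1) * fps_deriv (Y $$ (i, j))
          + Y $$ (i, j) * at_inf (r - 1) (pderiv (phi (int j + 1)))
        = (map_mat (at_inf (r - 1)) Q * Y) $$ (i, j))"

section \<open>Segments, fine Stokes sectors and canonical solutions\<close>

definition segment :: "nat \<Rightarrow> nat \<Rightarrow> int \<Rightarrow> complex set" where
  "segment k r l =
     {of_real \<rho> * cis \<theta> | \<rho> \<theta>. 0 < \<rho> \<and>
        pi * of_int (l - 1) / (real k * real r) < \<theta> \<and> \<theta> < pi * of_int l / (real k * real r)}"

definition closed_sector :: "real \<Rightarrow> real \<Rightarrow> complex set" where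
  "closed_sector \<alpha> \<beta> = {of_real \<rho> * cis \<theta> | \<rho> \<theta>. 0 < \<rho> \<and> \<alpha> \<le> \<theta> \<and> \<theta> \<le> \<beta>}"

text \<open>
  \<open>\<Psi>\<close> has the asymptotic expansion \<open>Y exp (g\<^sup>-\<^sup>1 diag phi)\<close> as \<open>\<zeta> \<rightarrow> \<infinity>\<close> in the fine Stokes sector
  \<open>D\<^sub>l\<close>. As usual for asymptotic expansions in an open sector, uniformity is required on closed
  subsectors only: uniformity up to the boundary rays would make the Stokes matrices trivial.
\<close>

definition asymptotic_in_sector ::
    "nat \<Rightarrow> nat \<Rightarrow> real \<Rightarrow> (int \<Rightarrow> complex poly) \<Rightarrow> complex fps mat \<Rightarrow> int \<Rightarrow>
     (complex \<Rightarrow> complex mat) \<Rightarrow> bool" where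
  "asymptotic_in_sector k r g phi Y l \<Psi> \<longleftrightarrow>
     (\<forall>\<alpha> \<beta>. pi * of_int (l - 1) / (real k * real r) < \<alpha> \<and> \<alpha> \<le> \<beta> \<and>
             \<beta> < pi * of_int (l + int k) / (real k * real r) \<longrightarrow>
        (\<forall>i<k. \<forall>j<k. \<forall>N.
           (\<lambda>z. \<Psi> z $$ (i, j) * exp (- poly (phi (int j + 1)) z / of_real g)
                - (\<Sum>n<N. fps_nth (Y $$ (i, j)) n / z ^ n))
           \<in> O[inf at_infinity (principal (closed_sector \<alpha> \<beta>))](\<lambda>z. 1 / z ^ N)))"

definition canonical_solution ::
    "nat \<Rightarrow> nat \<Rightarrow> real \<Rightarrow> complex poly mat \<Rightarrow> (int \<Rightarrow> complex poly) \<Rightarrow> complex fps mat \<Rightarrow> int \<Rightarrow>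
     (complex \<Rightarrow> complex mat) \<Rightarrow> bool" where
  "canonical_solution k r g Q phi Y l \<Psi> \<longleftrightarrow>
     matrix_solution k g Q \<Psi> \<and> asymptotic_in_sector k r g phi Y l \<Psi>"

definition stokes_matrices ::
    "nat \<Rightarrow> (int \<Rightarrow> complex \<Rightarrow> complex mat) \<Rightarrow> (int \<Rightarrow> complex mat) \<Rightarrow> bool" where
  "stokes_matrices k \<Psi> S \<longleftrightarrow>
     (\<forall>l. S l \<in> carrier_mat k k \<and> (\<forall>z. \<Psi> (l + 1) z = \<Psi> l z * S l))"

section \<open>Profile and theta parameters\<close>

text \<open>Row \<open>l\<close> of the profile: the labels \<open>1, \<dots>, k\<close> in the order of increasing
  \<open>Re (\<phi>\<^sup>(\<^sup>j\<^sup>)\<^sub>-\<^sub>r \<zeta> ^ r)\<close> on the \<open>l\<close>-th segment.\<close>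

definition profile_row :: "nat \<Rightarrow> nat \<Rightarrow> nat \<Rightarrow> int \<Rightarrow> int list" where
  "profile_row k r eps l =
     (THE js. set js = {1..int k} \<and>
        (\<forall>z\<in>segment k r l.
           sorted_wrt (\<lambda>i j. Re (phi_lead k r eps i * z ^ r) < Re (phi_lead k r eps j * z ^ r)) js))"

definition profile :: "nat \<Rightarrow> nat \<Rightarrow> nat \<Rightarrow> int \<Rightarrow> int \<Rightarrow> int" where
  "profile k r eps l n = profile_row k r eps l ! nat (n - 1)"

definition more_dominant :: "nat \<Rightarrow> nat \<Rightarrow> nat \<Rightarrow> int \<Rightarrow> int \<Rightarrow> int \<Rightarrow> bool" where
  "more_dominant k r eps l i j \<longleftrightarrow>
     (\<exists>m n. 1 \<le> m \<and> m < n \<and> n \<le> int k \<and> j = profile k r eps l m \<and> i = profile k r eps l n)"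

definition theta ::
    "nat \<Rightarrow> nat \<Rightarrow> nat \<Rightarrow> (int \<Rightarrow> complex mat) \<Rightarrow> int \<Rightarrow> int \<Rightarrow> complex" where
  "theta k r eps S A n =
     (if n = 0 then - 1
      else if n = int k then 1
      else let L = 2 * int r + A - n in
        entry k (S L) (profile k r eps L (int k - n + 1)) (profile k r eps L (int k - n)))"

section \<open>Multi-cut boundary conditions\<close>

text \<open>
  The possibly half-integral \<open>s = r q + a + eps r / 2\<close> occurs only through the integer \<open>2 s\<close>.
  For \<open>P = 2 r n + 2 s\<close>, \<open>dominant_index\<close> is the label \<open>1 + (r n + s - eps \<gamma> / 2) m\<^sub>1\<close>;
  there \<open>P - eps \<gamma>\<close> is even, so the division is exact.
\<close>

definition twice_s :: "nat \<Rightarrow> nat \<Rightarrow> nat \<Rightarrow> int \<Rightarrow> int" where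
  "twice_s r eps a q = 2 * (int r * q + int a) + int eps * int r"

definition dominant_index :: "nat \<Rightarrow> nat \<Rightarrow> nat \<Rightarrow> int \<Rightarrow> int \<Rightarrow> int" where
  "dominant_index k r eps m1 P = wrap k (1 + ((P - int eps * (int r - 2)) div 2) * m1)"

definition dominant_in_segment ::
    "nat \<Rightarrow> nat \<Rightarrow> nat \<Rightarrow> (int \<Rightarrow> complex vec) \<Rightarrow> int \<Rightarrow> int \<Rightarrow> bool" where
  "dominant_in_segment k r eps X p d \<longleftrightarrow>
     d \<in> {1..int k} \<and>
     (\<forall>l. l \<le> p \<and> p \<le> l + int k \<longrightarrow>
        component k (X l) d \<noteq> 0 \<and>
        (\<forall>j\<in>{1..int k}. more_dominant k r eps p j d \<longrightarrow> component k (X l) j = 0))"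

definition cut_direction :: "nat \<Rightarrow> nat \<Rightarrow> nat \<Rightarrow> nat \<Rightarrow> real \<Rightarrow> bool" where
  "cut_direction k r eps a \<theta> \<longleftrightarrow>
     (\<exists>n<k. \<exists>m::int. \<theta> = pi / real k * (1 - real eps) + 2 * pi * real a / (real r * real k)
                          + 2 * pi * real n / real k + 2 * pi * of_int m)"

text \<open>
  The second conjunct: the dominant term changes exactly across the \<open>k\<close> prescribed directions. The
  dominance order is constant on each segment, so only the rays \<open>\<pi> p / (k r)\<close> between the segments \<open>p\<close>
  and \<open>p + 1\<close> matter.
\<close>

definition multicut_condition ::
    "nat \<Rightarrow> nat \<Rightarrow> nat \<Rightarrow> int \<Rightarrow> nat \<Rightarrow> (int \<Rightarrow> complex vec) \<Rightarrow> bool" where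
  "multicut_condition k r eps m1 a X \<longleftrightarrow>
     (let s2 = twice_s r eps a 0 in
       (\<forall>N p. 2 * int r * N + s2 - int r + 1 \<le> p \<and> p \<le> 2 * int r * N + s2 + int r \<longrightarrow>
          dominant_in_segment k r eps X p (dominant_index k r eps m1 (2 * int r * N + s2)))) \<and>
     (\<forall>p. (\<exists>d d'. dominant_in_segment k r eps X p d \<and> dominant_in_segment k r eps X (p + 1) d' \<and>
                  d \<noteq> d')
          \<longleftrightarrow> cut_direction k r eps a (pi * of_int p / (real k * real r)))"

text \<open>\<open>y_seq k r eps m1 X (2 s) n\<close> is \<open>y\<^sub>n\<^sup>(\<^sup>2\<^sup>s\<^sup>)\<close>.\<close>

definition y_seq ::
    "nat \<Rightarrow> nat \<Rightarrow> nat \<Rightarrow> int \<Rightarrow> (int \<Rightarrow> complex vec) \<Rightarrow> int \<Rightarrow> int \<Rightarrow> complex" where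
  "y_seq k r eps m1 X A n =
     component k (X (2 * int r * n + A)) (dominant_index k r eps m1 (2 * int r * n + A))"

text \<open>
  For \<open>k < r\<close> and \<open>b = k\<close> the only summand below is \<open>\<theta>\<^sub>k y\<^sub>1 = y\<^sub>1\<close>, so the recursion contradicts
  \<open>y\<^sub>1 \<noteq> 0\<close>, and the theorem can hold only if the boundary condition is unsatisfiable. It is, except
  when \<open>2 k < r\<close> and \<open>0 < r mod 2 k < k\<close>: there the vanishing conditions and the structure of the
  Stokes matrices are compatible (for instance \<open>k = 2\<close>, \<open>r = 5\<close>). The theorem excludes this range.
\<close>

definition recursion_F ::
    "nat \<Rightarrow> nat \<Rightarrow> nat \<Rightarrow> (int \<Rightarrow> complex mat) \<Rightarrow> int \<Rightarrow> int \<Rightarrow> (int \<Rightarrow> complex) \<Rightarrow> complex" where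
  "recursion_F k r eps S A b y =
     (\<Sum>n | 0 \<le> int r * (n - 1) + b \<and> int r * (n - 1) + b \<le> int k.
        theta k r eps S (2 * int r * (n - 1) + A) (int r * (n - 1) + b) * y n)"

end

theory Submission
  imports Defs
begin

text \<open>
  On a ray inside two fine sectors, \<open>\<Psi>\<^sub>l exp (- phi / g)\<close> tends to the identity, so an entry \<open>(i, j)\<close> of
  a connection matrix vanishes unless \<open>Re (phi i - phi j)\<close> stays bounded above on every such ray. With the
  leading exponents equally spaced on the unit circle, this leaves in each row of \<open>S\<^sub>l\<close> at most one
  off-diagonal entry, and \<open>X\<^sup>(\<^sup>l\<^sup>) = S\<^sub>l X\<^sup>(\<^sup>l\<^sup>+\<^sup>1\<^sup>)\<close> becomes a scalar two-term relation for each component.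
  The boundary condition forces \<open>r < k\<close>. Summing the relations for one component \<open>i\<close> while it descends
  through the profile, from a row where the boundary condition kills it (or where it is dominant, if
  \<open>b = r\<close>) to the next such row, all contributions vanish except those of the dominant components:
  this is the recursion.
\<close>

section \<open>Profile\<close>

text \<open>All comparisons of exponents rest on one identity: on the ray of angle pi t / (k r), the
  real parts for \<open>lab u\<close> and \<open>lab v\<close> differ by a positive multiple of
  sin(pi (u - v) / k) sin(pi (t - (u + v + shift)) / k). Hence two labels exchange their order only
  on rays t congruent to u + v + shift modulo k, and statements about profiles, Stokes entries and
  vanishing components become sign checks on two sines. Here u and v are unreduced integers; adding
  k to one of them flips both sines, so whenever the sign of a single sine is used, the
  representatives are tied to the row by u + v + shift = l. For the dominant labels, the row
  \<open>P N\<close> equals 2 \<open>U N\<close> + \<open>shift\<close>, so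
  \<open>lab (U N + d)\<close> meets \<open>lab (U N)\<close> on the ray \<open>P N + d\<close>;
  this places every vanishing statement and every theta parameter.\<close>

lemma sin_pi_frac_pos: "0 < x \<Longrightarrow> x < real k \<Longrightarrow> 0 < sin (pi * x / real k)"
  by (intro sin_gt_zero) (auto simp: field_simps)

lemma sin_pi_frac_neg: "- real k < x \<Longrightarrow> x < 0 \<Longrightarrow> sin (pi * x / real k) < 0"
  using sin_pi_frac_pos[of "- x" k] by simp

text \<open>The zeros of sin(pi x / k) are multiples of \<open>k\<close>, so the sine keeps its sign
  strictly between \<open>h - 1\<close> and \<open>h\<close>. This is what makes the dominance order
  constant on a segment.\<close>

lemma sin_mult_pi_shift:
  fixes h :: int and k :: nat and s t :: real
  assumes "1 \<le> k" "0 < s" "s < 1" "0 < t" "t < 1"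
  shows "0 < sin (pi * (of_int h - s) / real k) * sin (pi * (of_int h - t) / real k)"
proof -
  define c j where "c = (h - 1) div int k" and "j = (h - 1) mod int k"
  have h: "h = int k * c + j + 1" by (simp add: c_def j_def)
  have j: "0 \<le> j" "j \<le> int k - 1"
    using assms(1) pos_mod_bound[of "int k" "h - 1"] by (auto simp: j_def)
  have "real_of_int j \<le> real k - 1" using j(2) by linarith
  then have pos: "0 < sin (pi * (of_int j + 1 - x) / real k)" if "0 < x" "x < 1" for x
    using that j(1) \<open>real_of_int j \<le> real k - 1\<close> by (intro sin_pi_frac_pos) linarith+
  have arg: "pi * (of_int h - x) / real k = pi * (of_int j + 1 - x) / real k + of_int c * pi" for x
    using assms(1) by (simp add: h field_simps)
  have eq: "sin (pi * (of_int h - x) / real k) = cos (of_int c * pi) * sin (pi * (of_int j + 1 - x) / real k)"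
    for x unfolding arg sin_add by (simp add: sin_zero_iff_int2)
  have "(cos (of_int c * pi))\<^sup>2 = 1"
    using sin_cos_squared_add[of "of_int c * pi"] sin_npi_int[of c] by (simp add: mult.commute)
  then have "sin (pi * (of_int h - s) / real k) * sin (pi * (of_int h - t) / real k)
    = sin (pi * (of_int j + 1 - s) / real k) * sin (pi * (of_int j + 1 - t) / real k)"
    unfolding eq by (simp add: power2_eq_square)
  then show ?thesis using pos assms by simp
qed

lemma sin_pi_frac_eq_0_iff:
  assumes "1 \<le> k"
  shows "sin (pi * of_int n / real k) = 0 \<longleftrightarrow> int k dvd n"
proof -
  have "pi * of_int n / real k = of_int i * pi \<longleftrightarrow> n = int k * i" for i
  proof -
    have "pi * of_int n / real k = of_int i * pi \<longleftrightarrow> real_of_int n = of_int (int k * i)"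
      using assms by (auto simp: field_simps)
    then show ?thesis using of_int_eq_iff by blast
  qed
  then show ?thesis by (auto simp: sin_zero_iff_int2 dvd_def)
qed

section \<open>Strictly sorted lists\<close>

lemma sorted_wrt_key_unique:
  fixes f :: "'a \<Rightarrow> 'b::linorder"
  assumes "sorted_wrt (\<lambda>x y. f x < f y) xs" "sorted_wrt (\<lambda>x y. f x < f y) ys" "set xs = set ys"
    and "inj_on f (set xs)"
  shows "xs = ys"
proof -
  have "map f xs = map f ys"
    by (rule strict_sorted_equal) (use assms in \<open>auto simp: sorted_wrt_map\<close>)
  then show ?thesis using assms by (metis inj_on_map_eq_map sup.idem)
qed

text \<open>Exactly the entries with larger keys follow \<open>x\<close>, so counting them locates
  it. Profile positions are computed this way, without listing a row.\<close>

lemma nth_sorted_wrt_key: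
  fixes f :: "'a \<Rightarrow> 'b::linorder"
  assumes "sorted_wrt (\<lambda>x y. f x < f y) xs" "x \<in> set xs"
  shows "xs ! (length xs - 1 - card {y \<in> set xs. f x < f y}) = x"
proof -
  obtain i where i: "i < length xs" "xs ! i = x" using assms(2) by (auto simp: in_set_conv_nth)
  have lt: "f (xs ! m) < f (xs ! n)" if "m < n" "n < length xs" for m n
    using sorted_wrt_nth_less[OF assms(1)] that by blast
  have inj: "inj_on ((!) xs) {..<length xs}"
    by (rule inj_onI) (metis lt lessThan_iff linorder_neqE_nat order_less_irrefl)
  have "{y \<in> set xs. f x < f y} = (!) xs ` {i<..<length xs}"
  proof (intro equalityI subsetI)
    fix y assume "y \<in> {y \<in> set xs. f x < f y}"
    then obtain m where m: "m < length xs" "y = xs ! m" "f x < f y" by (auto simp: in_set_conv_nth)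
    then have "i < m" using lt[of m i] i by (metis linorder_neqE_nat order_less_asym)
    then show "y \<in> (!) xs ` {i<..<length xs}" using m by auto
  qed (use lt i in auto)
  moreover have "inj_on ((!) xs) {i<..<length xs}" by (rule inj_on_subset[OF inj]) auto
  ultimately have "card {y \<in> set xs. f x < f y} = length xs - Suc i" by (simp add: card_image)
  then show ?thesis using i by simp
qed

text \<open>Labels are parametrised by \<open>u \<mapsto> 1 + u m\<^sub>1\<close>, for which \<open>\<gamma> (lab u - 1) \<equiv> u\<close> modulo \<open>k\<close>: the
  leading exponents then run through the unit circle in steps of \<open>2 \<pi> / k\<close>.\<close>

locale label_system =
  fixes k r eps :: nat and m1 :: int
  assumes k_pos: "1 \<le> k" and r_ge: "3 \<le> r" and m1: "[(int r - 2) * m1 = 1] (mod int k)"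
begin

definition shift :: int where "shift = int eps * (int r - 2)"

definition lab :: "int \<Rightarrow> int" where "lab u = wrap k (1 + u * m1)"

lemma lab_range: "lab u \<in> {1..int k}"
  using k_pos zless_imp_add1_zle[OF pos_mod_bound[of "int k" "u * m1"]]
  by (auto simp: lab_def wrap_def)

lemma lab_cong: "[(int r - 2) * (lab u - 1) = u] (mod int k)"
proof -
  have "[(int r - 2) * (lab u - 1) = (int r - 2) * (u * m1)] (mod int k)"
    by (auto simp: lab_def wrap_def cong_def mod_mult_right_eq)
  also have "[(int r - 2) * (u * m1) = u] (mod int k)"
    using cong_scalar_left[OF m1, of u] by (simp add: ac_simps)
  finally show ?thesis .
qed

lemma lab_eq_iff: "lab u = lab v \<longleftrightarrow> int k dvd u - v"
proof
  assume "lab u = lab v"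
  then have "[u = v] (mod int k)" using lab_cong[of u] lab_cong[of v] by (metis cong_sym cong_trans)
  then show "int k dvd u - v" by (simp add: cong_iff_dvd_diff)
next
  assume "int k dvd u - v"
  then have "[u * m1 = v * m1] (mod int k)" by (simp add: cong_iff_dvd_diff left_diff_distrib[symmetric])
  then show "lab u = lab v" by (auto simp: lab_def wrap_def cong_def)
qed

lemma lab_surj: "j \<in> {1..int k} \<Longrightarrow> lab ((int r - 2) * (j - 1)) = j"
proof -
  assume j: "j \<in> {1..int k}"
  have "[(j - 1) * ((int r - 2) * m1) = (j - 1) * 1] (mod int k)"
    using cong_scalar_left[OF m1] .
  then have "((int r - 2) * (j - 1) * m1) mod int k = (j - 1) mod int k"
    by (simp add: cong_def ac_simps)
  then show ?thesis using j by (simp add: lab_def wrap_def)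
qed

lemma labE:
  assumes "j \<in> {1..int k}" obtains u where "j = lab u" "u0 \<le> u" "u < u0 + int k"
proof -
  define v where "v = (int r - 2) * (j - 1)"
  have "int k dvd v - (u0 + (v - u0) mod int k)"
    by (metis diff_diff_eq dvd_minus_mod)
  then have "j = lab (u0 + (v - u0) mod int k)"
    using lab_surj[OF assms] lab_eq_iff unfolding v_def[symmetric] by blast
  then show ?thesis
    using that[of "u0 + (v - u0) mod int k"] k_pos by simp
qed

lemma phi_lead_lab:
  "phi_lead k r eps (lab u) = cis (- (2 * pi / real k) * (of_int u + of_int shift / 2))"
proof -
  obtain c where c: "(int r - 2) * (lab u - 1) = u + int k * c"
    using lab_cong[of u] by (metis cong_iff_lin cong_sym)
  have c': "(real r - 2) * of_int (lab u - 1) = of_int u + real k * of_int c"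
    using arg_cong[OF c, of real_of_int] by simp
  have "phi_lead k r eps (lab u)
      = cis (- (2 * pi / real k) * ((real r - 2) * of_int (lab u - 1) + (real r - 2) * (real eps / 2)))"
    unfolding phi_lead_def by (simp only: distrib_left mult.assoc)
  also have "\<dots> = cis (- (2 * pi / real k) * (of_int u + of_int shift / 2) + 2 * pi * of_int (- c))"
    unfolding c' using k_pos by (intro arg_cong[of _ _ cis]) (simp add: shift_def field_simps)
  also have "\<dots> = cis (- (2 * pi / real k) * (of_int u + of_int shift / 2))"
    by (subst cis_mult[symmetric]) (metis cis_multiple_2pi Ints_of_int mult.right_neutral)
  finally show ?thesis .
qed

text \<open>This is the formula for a difference of cosines. The first sine depends on the labels
  alone, the second also on the direction.\<close>

lemma Re_phi_lead_diff:
  "Re (phi_lead k r eps (lab u) * (of_real \<rho> * cis \<theta>) ^ r)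
     - Re (phi_lead k r eps (lab v) * (of_real \<rho> * cis \<theta>) ^ r)
   = 2 * \<rho> ^ r * (sin (pi * of_int (u - v) / real k)
       * sin (real r * \<theta> - pi * of_int (u + v + shift) / real k))"
proof -
  have Re: "Re (phi_lead k r eps (lab w) * (of_real \<rho> * cis \<theta>) ^ r)
      = \<rho> ^ r * cos (real r * \<theta> - (2 * pi / real k) * (of_int w + of_int shift / 2))" for w
  proof -
    have "phi_lead k r eps (lab w) * (of_real \<rho> * cis \<theta>) ^ r
      = of_real (\<rho> ^ r) * cis (real r * \<theta> - (2 * pi / real k) * (of_int w + of_int shift / 2))"
      by (simp add: phi_lead_lab power_mult_distrib Complex.DeMoivre cis_mult ac_simps)
    then show ?thesis by (simp only:) (simp add: cis.sel)
  qed
  define A B where "A = real r * \<theta> - (2 * pi / real k) * (of_int u + of_int shift / 2)"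
    and "B = real r * \<theta> - (2 * pi / real k) * (of_int v + of_int shift / 2)"
  have "(A + B) / 2 = real r * \<theta> - pi * of_int (u + v + shift) / real k"
    using k_pos by (simp add: A_def B_def field_simps)
  moreover have "(B - A) / 2 = pi * of_int (u - v) / real k"
    using k_pos by (simp add: A_def B_def field_simps)
  ultimately have "cos A - cos B = 2 * (sin (pi * of_int (u - v) / real k)
       * sin (real r * \<theta> - pi * of_int (u + v + shift) / real k))"
    by (simp only: cos_diff_cos mult.assoc) (simp only: mult.commute)
  then show ?thesis unfolding Re A_def[symmetric] B_def[symmetric]
    by (metis (no_types, opaque_lifting) mult.assoc mult.left_commute right_diff_distrib)
qed

text \<open>The real part at the point of modulus 1 on the bisector of segment \<open>l\<close>. The
  half-integral offset stays away from the rays on which two exponents can tie.\<close>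

definition rank_key :: "int \<Rightarrow> int \<Rightarrow> real" where
  "rank_key l j
     = Re (phi_lead k r eps j * (of_real 1 * cis (pi * (of_int l - 1 / 2) / (real k * real r))) ^ r)"

lemma rank_key_diff:
  "rank_key l (lab u) - rank_key l (lab v)
     = 2 * (sin (pi * of_int (u - v) / real k)
            * sin (pi * (of_int (l - (u + v + shift)) - 1 / 2) / real k))"
proof -
  have arg: "real r * (pi * (of_int l - 1 / 2) / (real k * real r)) - pi * of_int (u + v + shift) / real k
      = pi * (of_int (l - (u + v + shift)) - 1 / 2) / real k"
    using k_pos r_ge by (simp add: divide_simps) (simp add: algebra_simps)
  show ?thesis unfolding rank_key_def Re_phi_lead_diff arg by simp
qed

lemma rank_key_less_iff:
  "rank_key l (lab v) < rank_key l (lab u) \<longleftrightarrow>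
     0 < sin (pi * of_int (u - v) / real k)
         * sin (pi * (of_int (l - (u + v + shift)) - 1 / 2) / real k)"
  using rank_key_diff[of l u v] by linarith

lemma inj_rank_key: "inj_on (rank_key l) {1..int k}"
proof (rule inj_onI)
  fix i j assume ij: "i \<in> {1..int k}" "j \<in> {1..int k}" and eq: "rank_key l i = rank_key l j"
  obtain u v where uv: "i = lab u" "j = lab v" using ij by (metis lab_surj)
  have "sin (pi * (of_int (l - (u + v + shift)) - 1 / 2) / real k) \<noteq> 0"
    using sin_mult_pi_shift[of k "1 / 2" "1 / 2" "l - (u + v + shift)"] k_pos by auto
  then have "sin (pi * of_int (u - v) / real k) = 0"
    using rank_key_diff[of l u v] eq uv by auto
  then show "i = j" using sin_pi_frac_eq_0_iff[OF k_pos] lab_eq_iff uv by blast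
qed

lemma segment_order_iff:
  assumes z: "z \<in> segment k r l" and ij: "i \<in> {1..int k}" "j \<in> {1..int k}"
  shows "Re (phi_lead k r eps i * z ^ r) < Re (phi_lead k r eps j * z ^ r)
           \<longleftrightarrow> rank_key l i < rank_key l j"
proof -
  obtain \<rho> \<theta> where z: "z = of_real \<rho> * cis \<theta>" "0 < \<rho>"
      "pi * of_int (l - 1) / (real k * real r) < \<theta>" "\<theta> < pi * of_int l / (real k * real r)"
    using z by (auto simp: segment_def)
  \<comment> \<open>Chosen so that r \<open>\<theta>\<close> = pi (l - t) / k; the midpoint used in
    \<open>rank_key\<close> has t = 1/2.\<close>
  define t where "t = of_int l - real r * \<theta> * real k / pi"
  have t: "0 < t" "t < 1" using z(3,4) k_pos r_ge by (auto simp: t_def field_simps)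
  obtain u v where uv: "i = lab u" "j = lab v" using ij by (metis lab_surj)
  define A where "A = sin (pi * (of_int (l - (v + u + shift)) - t) / real k)"
  define B where "B = sin (pi * (of_int (l - (v + u + shift)) - 1 / 2) / real k)"
  define C where "C = sin (pi * of_int (v - u) / real k)"
  have AB: "0 < A * B" unfolding A_def B_def by (rule sin_mult_pi_shift) (use k_pos t in auto)
  have "real r * \<theta> - pi * of_int (v + u + shift) / real k
      = pi * (of_int (l - (v + u + shift)) - t) / real k"
    using k_pos by (simp add: t_def field_simps)
  then have "Re (phi_lead k r eps j * z ^ r) - Re (phi_lead k r eps i * z ^ r) = 2 * \<rho> ^ r * (C * A)"
    unfolding uv z(1) Re_phi_lead_diff A_def C_def by simp
  moreover have "0 < \<rho> ^ r" using z(2) by simp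
  ultimately have "Re (phi_lead k r eps i * z ^ r) < Re (phi_lead k r eps j * z ^ r) \<longleftrightarrow> 0 < C * A"
    by (metis diff_gt_0_iff_gt mult_pos_pos zero_less_mult_pos zero_less_numeral)
  also have "\<dots> \<longleftrightarrow> 0 < C * B" using AB by (auto simp: zero_less_mult_iff)
  also have "\<dots> \<longleftrightarrow> rank_key l i < rank_key l j"
    unfolding uv rank_key_less_iff B_def C_def ..
  finally show ?thesis .
qed

text \<open>The definite description is legitimate: sorting by \<open>rank_key\<close> gives a
  witness, injectivity of the key makes it unique, and the midpoint recovers the key order from the
  condition on the whole segment.\<close>

lemma profile_row:
  "set (profile_row k r eps l) = {1..int k}"
  "sorted_wrt (\<lambda>i j. rank_key l i < rank_key l j) (profile_row k r eps l)"
proof -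
  let ?P = "\<lambda>js. set js = {1..int k} \<and>
        (\<forall>z\<in>segment k r l.
           sorted_wrt (\<lambda>i j. Re (phi_lead k r eps i * z ^ r) < Re (phi_lead k r eps j * z ^ r)) js)"
  let ?Q = "\<lambda>js. set js = {1..int k} \<and> sorted_wrt (\<lambda>i j. rank_key l i < rank_key l j) js"
  have mid: "of_real 1 * cis (pi * (of_int l - 1 / 2) / (real k * real r)) \<in> segment k r l"
    unfolding segment_def mem_Collect_eq
    by (rule exI[of _ 1], rule exI[of _ "pi * (of_int l - 1 / 2) / (real k * real r)"])
      (use k_pos r_ge in \<open>auto simp: divide_strict_right_mono\<close>)
  have PQ: "?P js \<longleftrightarrow> ?Q js" for js
  proof
    assume P: "?P js"
    then have "sorted_wrt (\<lambda>i j. rank_key l i < rank_key l j) js"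
      using mid unfolding rank_key_def by blast
    then show "?Q js" using P by blast
  next
    assume Q: "?Q js"
    have "sorted_wrt (\<lambda>i j. Re (phi_lead k r eps i * z ^ r) < Re (phi_lead k r eps j * z ^ r)) js"
      if "z \<in> segment k r l" for z
      by (rule sorted_wrt_mono_rel[where P = "\<lambda>i j. rank_key l i < rank_key l j"])
        (use Q segment_order_iff[OF that] in auto)
    then show "?P js" using Q by blast
  qed
  define js where "js = sort_key (rank_key l) [1..int k]"
  have set: "set js = {1..int k}" by (simp add: js_def)
  have "sorted (map (rank_key l) js)" "distinct (map (rank_key l) js)"
    using inj_rank_key[of l] by (auto simp: js_def distinct_map)
  then have "sorted_wrt (<) (map (rank_key l) js)" by (simp add: strict_sorted_iff)
  then have "?Q js" using set by (simp add: sorted_wrt_map)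
  moreover have "js' = js" if "?Q js'" for js'
    by (rule sorted_wrt_key_unique) (use that \<open>?Q js\<close> inj_rank_key[of l] in auto)
  ultimately have "\<exists>!js. ?P js" unfolding PQ by blast
  then have "?P (profile_row k r eps l)" unfolding profile_row_def by (rule theI')
  then have "?Q (profile_row k r eps l)" unfolding PQ .
  then show "set (profile_row k r eps l) = {1..int k}"
    "sorted_wrt (\<lambda>i j. rank_key l i < rank_key l j) (profile_row k r eps l)" by auto
qed

lemma length_profile_row: "length (profile_row k r eps l) = k"
proof -
  have "distinct (map (rank_key l) (profile_row k r eps l))"
    using profile_row(2)[of l] strict_sorted_iff by (auto simp: sorted_wrt_map[symmetric])
  then show ?thesis using distinct_card[of "profile_row k r eps l"] profile_row(1)[of l]
    by (simp add: distinct_map)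
qed

lemma profile_eqI:
  assumes "j \<in> {1..int k}" "int (card {i \<in> {1..int k}. rank_key l j < rank_key l i}) = int k - n"
  shows "profile k r eps l n = j"
proof -
  have "length (profile_row k r eps l) - 1 - card {i \<in> {1..int k}. rank_key l j < rank_key l i}
      = nat (n - 1)"
    using assms(2) unfolding length_profile_row by linarith
  then show ?thesis
    using nth_sorted_wrt_key[OF profile_row(2), of j l] assms(1) by (simp add: profile_row(1) profile_def)
qed

lemma more_dominantI:
  assumes ij: "i \<in> {1..int k}" "j \<in> {1..int k}" and less: "rank_key l j < rank_key l i"
  shows "more_dominant k r eps l i j"
proof -
  let ?xs = "profile_row k r eps l"
  obtain m n where m: "m < k" "?xs ! m = j" and n: "n < k" "?xs ! n = i"
    using ij by (metis in_set_conv_nth profile_row(1) length_profile_row)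
  have "m < n"
  proof (rule ccontr)
    assume "\<not> m < n"
    then have "n = m \<or> rank_key l (?xs ! n) < rank_key l (?xs ! m)"
      using sorted_wrt_nth_less[OF profile_row(2), of n m l] m(1)
      unfolding length_profile_row by linarith
    then show False using m n less by auto
  qed
  then show ?thesis unfolding more_dominant_def profile_def
    by (intro exI[of _ "int m + 1"] exI[of _ "int n + 1"]) (use m n in auto)
qed

lemma more_dominant_labI:
  assumes "0 < sin (pi * of_int (u - v) / real k)
         * sin (pi * (of_int (l - (u + v + shift)) - 1 / 2) / real k)"
  shows "more_dominant k r eps l (lab u) (lab v)"
  by (intro more_dominantI lab_range) (use assms rank_key_less_iff in blast)

end

section \<open>Connection matrices on a ray\<close>

text \<open>The difference e - b = -(A - I) e has size at most \<open>\<eta>\<close> times that of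
  e, and \<open>\<eta> \<le> 1 / 2\<close> bounds the size of e by twice that of b.\<close>

lemma near_identity_bound:
  fixes A :: "nat \<Rightarrow> nat \<Rightarrow> complex" and e :: "nat \<Rightarrow> complex"
  assumes "\<eta> \<le> 1 / 2" and \<eta>: "\<eta> = (\<Sum>i<k. \<Sum>m<k. cmod (A i m - of_bool (i = m)))"
  defines "b \<equiv> \<lambda>i. \<Sum>m<k. A i m * e m"
  shows "(\<Sum>i<k. cmod (e i - b i)) \<le> 2 * \<eta> * (\<Sum>i<k. cmod (b i))"
proof -
  define s where "s = (\<Sum>i<k. cmod (e i))"
  have "\<eta> \<ge> 0" unfolding \<eta> by (intro sum_nonneg) auto
  have diff: "e i - b i = - (\<Sum>m<k. (A i m - of_bool (i = m)) * e m)" if "i < k" for i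
  proof -
    have "(\<Sum>m<k. of_bool (i = m) * e m) = e i"
      using that by (simp add: sum.delta[of "{..<k}" i e, simplified] of_bool_def if_distrib[of "\<lambda>x. x * _"] cong: if_cong)
    then show ?thesis by (simp add: b_def left_diff_distrib sum_subtractf)
  qed
  have "(\<Sum>i<k. cmod (e i - b i)) \<le> (\<Sum>i<k. \<Sum>m<k. cmod (A i m - of_bool (i = m)) * s)"
  proof (rule sum_mono)
    fix i assume "i \<in> {..<k}"
    then have "cmod (e i - b i) \<le> (\<Sum>m<k. cmod ((A i m - of_bool (i = m)) * e m))"
      by (simp add: diff sum_norm_le)
    also have "\<dots> \<le> (\<Sum>m<k. cmod (A i m - of_bool (i = m)) * s)"
    proof (rule sum_mono)
      fix m assume "m \<in> {..<k}"
      then have "cmod (e m) \<le> s" unfolding s_def by (intro member_le_sum) auto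
      then show "cmod ((A i m - of_bool (i = m)) * e m) \<le> cmod (A i m - of_bool (i = m)) * s"
        by (simp add: norm_mult mult_left_mono)
    qed
    finally show "cmod (e i - b i) \<le> (\<Sum>m<k. cmod (A i m - of_bool (i = m)) * s)" .
  qed
  also have "\<dots> = \<eta> * s" by (simp add: \<eta> sum_distrib_right)
  finally have 1: "(\<Sum>i<k. cmod (e i - b i)) \<le> \<eta> * s" .
  have "s \<le> (\<Sum>i<k. cmod (e i - b i) + cmod (b i))"
    unfolding s_def by (intro sum_mono) (metis diff_add_cancel norm_triangle_ineq)
  also have "\<dots> \<le> s / 2 + (\<Sum>i<k. cmod (b i))"
  proof -
    have "\<eta> * s \<le> 1 / 2 * s"
      using assms(1) by (intro mult_right_mono) (auto simp: s_def sum_nonneg)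
    then show ?thesis using 1 by (simp add: sum.distrib)
  qed
  finally have "s \<le> 2 * (\<Sum>i<k. cmod (b i))" by simp
  then have "\<eta> * s \<le> \<eta> * (2 * (\<Sum>i<k. cmod (b i)))" using \<open>\<eta> \<ge> 0\<close> by (rule mult_left_mono)
  then show ?thesis using 1 by simp
qed

text \<open>The vectors \<open>e t\<close> come without any bound; in the application they contain
  exponentials that may grow. The previous estimate controls them by the convergent products
  alone.\<close>

lemma tendsto_near_identity:
  fixes A :: "'a \<Rightarrow> nat \<Rightarrow> nat \<Rightarrow> complex" and e :: "'a \<Rightarrow> nat \<Rightarrow> complex"
  assumes A: "\<And>i m. i < k \<Longrightarrow> m < k \<Longrightarrow> ((\<lambda>t. A t i m) \<longlongrightarrow> of_bool (i = m)) F"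
    and b: "\<And>i. i < k \<Longrightarrow> ((\<lambda>t. \<Sum>m<k. A t i m * e t m) \<longlongrightarrow> \<beta> i) F"
    and i: "i < k"
  shows "((\<lambda>t. e t i) \<longlongrightarrow> \<beta> i) F"
proof -
  define \<eta> where "\<eta> t = (\<Sum>i<k. \<Sum>m<k. cmod (A t i m - of_bool (i = m)))" for t
  define b' where "b' t i = (\<Sum>m<k. A t i m * e t m)" for t i
  have "(\<eta> \<longlongrightarrow> (\<Sum>i<k. \<Sum>m<k. cmod (of_bool (i = m) - of_bool (i = m)))) F"
    unfolding \<eta>_def by (intro tendsto_intros A) auto
  then have \<eta>: "(\<eta> \<longlongrightarrow> 0) F" by simp
  have "((\<lambda>t. 2 * \<eta> t * (\<Sum>i<k. cmod (b' t i))) \<longlongrightarrow> 2 * 0 * (\<Sum>i<k. cmod (\<beta> i))) F"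
    unfolding b'_def by (intro tendsto_intros \<eta> b) auto
  then have lim: "((\<lambda>t. 2 * \<eta> t * (\<Sum>i<k. cmod (b' t i))) \<longlongrightarrow> 0) F" by simp
  have "\<forall>\<^sub>F t in F. \<eta> t < 1 / 2" using \<eta> by (rule order_tendstoD) simp
  then have "\<forall>\<^sub>F t in F. norm (e t i - b' t i) \<le> norm (2 * \<eta> t * (\<Sum>i<k. cmod (b' t i))) * 1"
  proof eventually_elim
    case (elim t)
    have "norm (e t i - b' t i) \<le> (\<Sum>i<k. cmod (e t i - b' t i))"
      using i by (intro member_le_sum) auto
    also have "\<dots> \<le> 2 * \<eta> t * (\<Sum>i<k. cmod (b' t i))"
      unfolding b'_def by (rule near_identity_bound) (use elim \<eta>_def in auto)
    finally show ?case by simp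
  qed
  then have "((\<lambda>t. e t i - b' t i) \<longlongrightarrow> 0) F" by (rule tendsto_0_le[OF lim])
  from tendsto_add[OF this b[OF i, folded b'_def]] show ?thesis by simp
qed

lemma Re_poly_on_ray_bounded_below:
  fixes p :: "complex poly" and c :: complex
  assumes "degree p \<le> r" "0 < Re (coeff p r * c ^ r)"
  obtains C where "0 < C" "\<forall>\<^sub>F \<rho> in at_top. C \<le> Re (poly p (of_real \<rho> * c))"
proof -
  define q where "q = (\<Sum>i\<le>r. monom (Re (coeff p i * c ^ i)) i)"
  have "poly p (of_real \<rho> * c) = (\<Sum>i\<le>r. of_real (\<rho> ^ i) * (coeff p i * c ^ i))" for \<rho>
    unfolding poly_as_sum_of_monoms'[OF assms(1), symmetric, THEN arg_cong[of _ _ "\<lambda>p. poly p _"]]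
    by (simp add: poly_sum poly_monom power_mult_distrib ac_simps)
  then have Re: "Re (poly p (of_real \<rho> * c)) = poly q \<rho>" for \<rho>
    by (simp add: q_def poly_sum poly_monom mult.commute)
  have coeff: "coeff q n = (if n \<le> r then Re (coeff p n * c ^ n) else 0)" for n
    by (simp add: q_def coeff_sum coeff_monom)
  have "degree q = r"
    using assms(2) by (intro antisym degree_le le_degree) (auto simp: coeff)
  then have lc: "0 < lead_coeff q" using assms(2) by (simp add: coeff)
  from poly_pinfty_gt_lc[OF lc] show ?thesis
    using that[OF lc] unfolding Re eventually_at_top_linorder by blast
qed

text \<open>The leading order of the asymptotic expansion in a single direction, from which all
  constraints on connection matrices are drawn.\<close>

definition normalized_on_ray ::
    "nat \<Rightarrow> real \<Rightarrow> (int \<Rightarrow> complex poly) \<Rightarrow> real \<Rightarrow> (complex \<Rightarrow> complex mat) \<Rightarrow> bool" where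
  "normalized_on_ray k g phi \<theta> \<Psi> \<longleftrightarrow>
     (\<forall>i<k. \<forall>j<k. ((\<lambda>\<rho>. \<Psi> (of_real \<rho> * cis \<theta>) $$ (i, j)
           * exp (- poly (phi (int j + 1)) (of_real \<rho> * cis \<theta>) / of_real g))
        \<longlongrightarrow> of_bool (i = j)) at_top)"

lemma filterlim_ray:
  "filterlim (\<lambda>\<rho>. of_real \<rho> * cis \<theta>) (inf at_infinity (principal (closed_sector \<theta> \<theta>))) at_top"
  unfolding filterlim_inf filterlim_principal
proof
  have "filterlim (\<lambda>\<rho>. norm (of_real \<rho> * cis \<theta>)) at_top at_top"
    by (simp add: norm_mult filterlim_abs_real)
  then show "filterlim (\<lambda>\<rho>. of_real \<rho> * cis \<theta>) at_infinity at_top"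
    by (rule filterlim_norm_at_top_imp_at_infinity)
  show "\<forall>\<^sub>F \<rho> in at_top. of_real \<rho> * cis \<theta> \<in> closed_sector \<theta> \<theta>"
    using eventually_gt_at_top[of 0] by eventually_elim (auto simp: closed_sector_def)
qed

lemma asymptotic_imp_normalized_on_ray:
  assumes asym: "asymptotic_in_sector k r g phi Y l \<Psi>" and form: "formal_solution k r g Q phi Y"
    and \<theta>: "pi * of_int (l - 1) / (real k * real r) < \<theta>"
            "\<theta> < pi * of_int (l + int k) / (real k * real r)"
  shows "normalized_on_ray k g phi \<theta> \<Psi>"
  unfolding normalized_on_ray_def
proof (intro allI impI)
  fix i j assume ij: "i < k" "j < k"
  define h where "h \<rho> = of_real \<rho> * cis \<theta>" for \<rho>
  define f where "f z = \<Psi> z $$ (i, j) * exp (- poly (phi (int j + 1)) z / of_real g)" for z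
  \<comment> \<open>The closed sector degenerates to one ray, and truncation at N = 1 leaves the
    constant term of the series with error O(1/z).\<close>
  have "\<forall>N. (\<lambda>z. f z - (\<Sum>n<N. fps_nth (Y $$ (i, j)) n / z ^ n))
           \<in> O[inf at_infinity (principal (closed_sector \<theta> \<theta>))](\<lambda>z. 1 / z ^ N)"
    using asym[unfolded asymptotic_in_sector_def, rule_format, of \<theta> \<theta> i j] \<theta> ij unfolding f_def
    by simp
  from this[rule_format, of 1] have
    "(\<lambda>z. f z - fps_nth (Y $$ (i, j)) 0)
       \<in> O[inf at_infinity (principal (closed_sector \<theta> \<theta>))](\<lambda>z. 1 / z)" by simp
  from landau_o.big.compose[OF this filterlim_ray]
  have "(\<lambda>\<rho>. f (h \<rho>) - fps_nth (Y $$ (i, j)) 0) \<in> O(\<lambda>\<rho>. 1 / h \<rho>)" by (simp add: h_def)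
  then obtain c where
    c: "\<forall>\<^sub>F \<rho> in at_top. norm (f (h \<rho>) - fps_nth (Y $$ (i, j)) 0) \<le> norm (1 / h \<rho>) * c"
    by (elim landau_o.bigE) (simp add: mult.commute)
 have "filterlim h at_infinity at_top"
    using filterlim_ray[of \<theta>] unfolding filterlim_inf h_def by blast
  then have "((\<lambda>\<rho>. 1 / h \<rho>) \<longlongrightarrow> 0) at_top" by (rule tendsto_divide_0[OF tendsto_const])
  then have "((\<lambda>\<rho>. f (h \<rho>) - fps_nth (Y $$ (i, j)) 0) \<longlongrightarrow> 0) at_top"
    using c by (rule tendsto_0_le)
  then have "((\<lambda>\<rho>. f (h \<rho>)) \<longlongrightarrow> fps_nth (Y $$ (i, j)) 0) at_top"
    using LIM_zero_iff by blast
  moreover have "fps_nth (Y $$ (i, j)) 0 = of_bool (i = j)"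
    using form ij by (simp add: formal_solution_def)
  ultimately show "((\<lambda>\<rho>. \<Psi> (of_real \<rho> * cis \<theta>) $$ (i, j)
           * exp (- poly (phi (int j + 1)) (of_real \<rho> * cis \<theta>) / of_real g))
        \<longlongrightarrow> of_bool (i = j)) at_top" unfolding f_def h_def by simp
qed

text \<open>With E = diag exp(phi / g), the vector Psi v exp(-phi_j / g) is (Psi E^-1) applied to E
  v exp(-phi_j / g). The first factor tends to the identity, so the limit passes to the
  second.\<close>

lemma normalized_on_ray_solve:
  assumes norm: "normalized_on_ray k g phi \<theta> \<Psi>"
    and lim: "\<And>i. i < k \<Longrightarrow> ((\<lambda>\<rho>. (\<Sum>m<k. \<Psi> (of_real \<rho> * cis \<theta>) $$ (i, m) * v m)
           * exp (- poly (phi (int j + 1)) (of_real \<rho> * cis \<theta>) / of_real g)) \<longlongrightarrow> \<beta> i) at_top"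
    and m: "m < k"
  shows "((\<lambda>\<rho>. exp (poly (phi (int m + 1) - phi (int j + 1)) (of_real \<rho> * cis \<theta>) / of_real g) * v m)
           \<longlongrightarrow> \<beta> m) at_top"
proof (rule tendsto_near_identity[OF _ _ m])
  show "((\<lambda>\<rho>. \<Psi> (of_real \<rho> * cis \<theta>) $$ (i, m)
           * exp (- poly (phi (int m + 1)) (of_real \<rho> * cis \<theta>) / of_real g))
        \<longlongrightarrow> of_bool (i = m)) at_top" if "i < k" "m < k" for i m
    using norm that by (simp add: normalized_on_ray_def)
  have exp: "exp (- a / c) * exp ((a - b) / c) = exp (- b / c)" for a b c :: complex
    by (simp add: exp_add[symmetric] diff_divide_distrib)
  have summand: "\<Psi> z $$ (i, n) * exp (- poly (phi (int n + 1)) z / of_real g)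
      * (exp (poly (phi (int n + 1) - phi (int j + 1)) z / of_real g) * v n)
    = \<Psi> z $$ (i, n) * v n * exp (- poly (phi (int j + 1)) z / of_real g)" for z i n
    using exp[of "poly (phi (int n + 1)) z" "of_real g" "poly (phi (int j + 1)) z"]
    by (simp add: ac_simps)
  show "((\<lambda>\<rho>. \<Sum>n<k. \<Psi> (of_real \<rho> * cis \<theta>) $$ (i, n)
           * exp (- poly (phi (int n + 1)) (of_real \<rho> * cis \<theta>) / of_real g)
      * (exp (poly (phi (int n + 1) - phi (int j + 1)) (of_real \<rho> * cis \<theta>) / of_real g) * v n))
      \<longlongrightarrow> \<beta> i) at_top" if "i < k" for i
    using lim[OF that] unfolding summand sum_distrib_right .
qed

lemma connection_matrix_entry_tendsto:
  assumes "normalized_on_ray k g phi \<theta> \<Psi>" "normalized_on_ray k g phi \<theta> \<Psi>'"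
    and dim: "\<And>z. \<Psi> z \<in> carrier_mat k k" "T \<in> carrier_mat k k" and eq: "\<And>z. \<Psi>' z = \<Psi> z * T"
    and mj: "m < k" "j < k"
  shows "((\<lambda>\<rho>. exp (poly (phi (int m + 1) - phi (int j + 1)) (of_real \<rho> * cis \<theta>) / of_real g)
             * T $$ (m, j)) \<longlongrightarrow> of_bool (m = j)) at_top"
proof (rule normalized_on_ray_solve[OF assms(1) _ mj(1), where \<beta> = "\<lambda>i. of_bool (i = j)"])
  fix i assume i: "i < k"
  have "\<Psi>' z $$ (i, j) = (\<Sum>m<k. \<Psi> z $$ (i, m) * T $$ (m, j))" for z
    using dim(1)[of z] dim(2) i mj by (simp add: eq scalar_prod_def atLeast0LessThan)
  then show "((\<lambda>\<rho>. (\<Sum>m<k. \<Psi> (of_real \<rho> * cis \<theta>) $$ (i, m) * T $$ (m, j))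
       * exp (- poly (phi (int j + 1)) (of_real \<rho> * cis \<theta>) / of_real g)) \<longlongrightarrow> of_bool (i = j)) at_top"
    using assms(2)[unfolded normalized_on_ray_def, rule_format, OF i mj(2)] by (simp only:)
qed

lemma connection_matrix_diag:
  assumes "normalized_on_ray k g phi \<theta> \<Psi>" "normalized_on_ray k g phi \<theta> \<Psi>'"
    and "\<And>z. \<Psi> z \<in> carrier_mat k k" "T \<in> carrier_mat k k" and "\<And>z. \<Psi>' z = \<Psi> z * T"
    and "j < k"
  shows "T $$ (j, j) = 1"
proof -
  have "((\<lambda>\<rho>::real. T $$ (j, j)) \<longlongrightarrow> 1) at_top"
    using connection_matrix_entry_tendsto[OF assms(1-5) assms(6) assms(6)] by simp
  then show ?thesis by (simp add: tendsto_const_iff)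
qed

text \<open>The exponential multiplying \<open>T $$ (m, j)\<close> eventually has modulus at least
  1, so their product can tend to 0 only if the entry is 0.\<close>

lemma connection_matrix_eq_0:
  assumes "normalized_on_ray k g phi \<theta> \<Psi>" "normalized_on_ray k g phi \<theta> \<Psi>'"
    and "\<And>z. \<Psi> z \<in> carrier_mat k k" "T \<in> carrier_mat k k" and "\<And>z. \<Psi>' z = \<Psi> z * T"
    and mj: "m < k" "j < k" "m \<noteq> j" and "0 < g"
    and deg: "degree (phi (int m + 1)) \<le> r" "degree (phi (int j + 1)) \<le> r"
    and pos: "0 < Re ((coeff (phi (int m + 1)) r - coeff (phi (int j + 1)) r) * cis \<theta> ^ r)"
  shows "T $$ (m, j) = 0"
proof -
  let ?p = "phi (int m + 1) - phi (int j + 1)"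
  have "degree ?p \<le> r" using deg by (simp add: degree_diff_le)
  then obtain C where "0 < C" and C: "\<forall>\<^sub>F \<rho> in at_top. C \<le> Re (poly ?p (of_real \<rho> * cis \<theta>))"
    using Re_poly_on_ray_bounded_below[of ?p r "cis \<theta>"] pos by auto
  from C have "\<forall>\<^sub>F \<rho> in at_top. norm (T $$ (m, j))
      \<le> norm (exp (poly ?p (of_real \<rho> * cis \<theta>) / of_real g) * T $$ (m, j)) * 1"
  proof eventually_elim
    case (elim \<rho>)
    have "1 \<le> norm (exp (poly ?p (of_real \<rho> * cis \<theta>) / of_real g))"
      using elim \<open>0 < C\<close> \<open>0 < g\<close> by simp
    then have "1 * norm (T $$ (m, j))
        \<le> norm (exp (poly ?p (of_real \<rho> * cis \<theta>) / of_real g)) * norm (T $$ (m, j))"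
      by (rule mult_right_mono) simp
    then show ?case by (simp add: norm_mult)
  qed
  moreover have "((\<lambda>\<rho>. exp (poly ?p (of_real \<rho> * cis \<theta>) / of_real g) * T $$ (m, j)) \<longlongrightarrow> 0) at_top"
    using connection_matrix_entry_tendsto[OF assms(1-5) mj(1,2)] mj(3) by simp
  ultimately have "((\<lambda>\<rho>::real. T $$ (m, j)) \<longlongrightarrow> 0) at_top" by (rule tendsto_0_le[rotated])
  then show ?thesis by (simp add: tendsto_const_iff)
qed

text \<open>The limit argument with limit 0, applied to v - w, kills each coordinate; this takes the
  place of invertibility of Psi.\<close>

lemma normalized_on_ray_inj:
  assumes norm: "normalized_on_ray k g phi \<theta> \<Psi>" and dim: "\<And>z. \<Psi> z \<in> carrier_mat k k"
    and v: "v \<in> carrier_vec k" and w: "w \<in> carrier_vec k" and eq: "\<And>z. \<Psi> z *\<^sub>v v = \<Psi> z *\<^sub>v w"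
  shows "v = w"
proof (rule eq_vecI)
  fix j assume "j < dim_vec w"
  then have j: "j < k" using w by simp
  have "(\<Sum>m<k. \<Psi> z $$ (i, m) * (vec_index v m - vec_index w m)) = 0" if "i < k" for i z
  proof -
    have "vec_index (\<Psi> z *\<^sub>v x) i = (\<Sum>m<k. \<Psi> z $$ (i, m) * vec_index x m)" if "x \<in> carrier_vec k" for x
      using that dim[of z] \<open>i < k\<close> by (simp add: scalar_prod_def atLeast0LessThan)
    from this[OF v] this[OF w] show ?thesis
      by (simp add: eq right_diff_distrib sum_subtractf)
  qed
  then have lim: "((\<lambda>\<rho>. (\<Sum>m<k. \<Psi> (of_real \<rho> * cis \<theta>) $$ (i, m) * (vec_index v m - vec_index w m))
      * exp (- poly (phi (int j + 1)) (of_real \<rho> * cis \<theta>) / of_real g)) \<longlongrightarrow> 0) at_top"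
    if "i < k" for i using that by (simp only: mult_zero_left tendsto_const)
  have "((\<lambda>\<rho>. exp (poly (phi (int j + 1) - phi (int j + 1)) (of_real \<rho> * cis \<theta>) / of_real g)
      * (vec_index v j - vec_index w j)) \<longlongrightarrow> 0) at_top"
    by (rule normalized_on_ray_solve[OF norm lim j])
  then show "vec_index v j = vec_index w j" by (simp add: tendsto_const_iff)
qed (use v w in simp)

lemma normalized_on_ray_2pi:
  "normalized_on_ray k g phi (\<theta> + 2 * pi) \<Psi> \<longleftrightarrow> normalized_on_ray k g phi \<theta> \<Psi>"
proof -
  have "cis (\<theta> + 2 * pi) = cis \<theta>" by (simp add: complex_eq_iff)
  then show ?thesis by (simp only: normalized_on_ray_def)
qed

section \<open>Stokes matrices\<close>

locale stokes_data = label_system +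
  fixes g :: real and Q :: "complex poly mat" and phi :: "int \<Rightarrow> complex poly" and Y :: "complex fps mat"
    and Psi :: "int \<Rightarrow> complex \<Rightarrow> complex mat" and S :: "int \<Rightarrow> complex mat"
    and psi :: "complex \<Rightarrow> complex vec" and X :: "int \<Rightarrow> complex vec"
  assumes g_pos: "0 < g" and exponents: "exponents k r eps phi"
    and formal: "formal_solution k r g Q phi Y"
    and canonical: "canonical_solution k r g Q phi Y l (Psi l)"
    and stokes: "stokes_matrices k Psi S"
    and X_dim: "X l \<in> carrier_vec k" and psi_eq: "psi z = Psi l z *\<^sub>v X l"
begin

definition pos :: "int \<Rightarrow> nat" where "pos u = nat (lab u - 1)"

lemma pos_less: "pos u < k"
  using lab_range[of u] by (auto simp: pos_def)

lemma int_pos: "int (pos u) + 1 = lab u"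
  using lab_range[of u] by (auto simp: pos_def)

lemma pos_eq_iff: "pos u = pos v \<longleftrightarrow> lab u = lab v"
  using int_pos by (metis add_right_cancel of_nat_eq_iff)

lemma entry_lab: "entry k M (lab u) (lab v) = M $$ (pos u, pos v)"
  using lab_range[of u] lab_range[of v] by (simp add: entry_def pos_def)

lemma component_lab: "component k v (lab u) = vec_index v (pos u)"
  using lab_range[of u] by (simp add: component_def pos_def)

lemma posE:
  assumes "m < k" obtains u where "m = pos u" "u0 \<le> u" "u < u0 + int k"
proof -
  obtain u where u: "int m + 1 = lab u" "u0 \<le> u" "u < u0 + int k"
    using labE[of "int m + 1" u0] assms by auto
  then have "m = pos u" using int_pos[of u] by linarith
  then show ?thesis using that u by blast
qed

lemma Psi_dim: "Psi l z \<in> carrier_mat k k"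
  using canonical by (simp add: canonical_solution_def matrix_solution_def)

lemma S_dim: "S l \<in> carrier_mat k k" and Psi_Suc: "Psi (l + 1) z = Psi l z * S l"
  using stokes by (auto simp: stokes_matrices_def)

text \<open>Directions in units of the segment width: segment \<open>l\<close> is l - 1 < t < l, and
  the fine sector \<open>D_l\<close> is l - 1 < t < l + k.\<close>

definition ray :: "real \<Rightarrow> real" where "ray t = pi * t / (real k * real r)"

lemma normalized_Psi:
  assumes "of_int l - 1 < t" "t < of_int l + real k"
  shows "normalized_on_ray k g phi (ray t) (Psi l)"
proof (rule asymptotic_imp_normalized_on_ray)
  show "asymptotic_in_sector k r g phi Y l (Psi l)"
    using canonical by (simp add: canonical_solution_def)
  show "formal_solution k r g Q phi Y" by (rule formal)
qed (use assms k_pos r_ge in \<open>auto simp: ray_def divide_strict_right_mono\<close>)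

lemma connection_eq_0:
  assumes norm: "normalized_on_ray k g phi (ray t) \<Psi>" "normalized_on_ray k g phi (ray t) \<Psi>'"
    and dim: "\<And>z. \<Psi> z \<in> carrier_mat k k" "T \<in> carrier_mat k k" and eq: "\<And>z. \<Psi>' z = \<Psi> z * T"
    and ne: "lab u \<noteq> lab v"
    and pos: "0 < sin (pi * of_int (u - v) / real k) * sin (pi * (t - of_int (u + v + shift)) / real k)"
  shows "T $$ (pos u, pos v) = 0"
proof (rule connection_matrix_eq_0[OF norm dim eq])
  have coeff: "degree (phi (lab w)) = r" "coeff (phi (lab w)) r = phi_lead k r eps (lab w) / of_nat r" for w
    using exponents lab_range[of w] by (auto simp: exponents_def)
  show "degree (phi (int (pos u) + 1)) \<le> r" "degree (phi (int (pos v) + 1)) \<le> r"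
    by (simp_all add: int_pos coeff)
  have arg: "real r * ray t - pi * of_int (u + v + shift) / real k
      = pi * (t - of_int (u + v + shift)) / real k"
    using k_pos r_ge by (simp add: ray_def field_simps)
  have "(phi_lead k r eps (lab u) / of_nat r - phi_lead k r eps (lab v) / of_nat r) * cis (ray t) ^ r
      = (phi_lead k r eps (lab u) * (of_real 1 * cis (ray t)) ^ r
         - phi_lead k r eps (lab v) * (of_real 1 * cis (ray t)) ^ r) / of_nat r"
    by (simp add: diff_divide_distrib left_diff_distrib)
  then have "Re ((coeff (phi (lab u)) r - coeff (phi (lab v)) r) * cis (ray t) ^ r)
      = 2 * 1 ^ r * (sin (pi * of_int (u - v) / real k)
          * sin (pi * (t - of_int (u + v + shift)) / real k)) / real r"
    unfolding coeff arg[symmetric] Re_phi_lead_diff[symmetric] by simp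
  then show "0 < Re ((coeff (phi (int (pos u) + 1)) r - coeff (phi (int (pos v) + 1)) r) * cis (ray t) ^ r)"
    unfolding int_pos using pos r_ge by simp
qed (use pos_less ne pos_eq_iff g_pos in auto)

text \<open>On a window of \<open>k\<close> segments the difference of the two leading exponents keeps its sign only if it
  vanishes on both boundary rays.\<close>

lemma connection_nonzero:
  assumes norm: "\<And>t. of_int l < t \<Longrightarrow> t < of_int l + real k \<Longrightarrow> normalized_on_ray k g phi (ray t) \<Psi>"
      "\<And>t. of_int l < t \<Longrightarrow> t < of_int l + real k \<Longrightarrow> normalized_on_ray k g phi (ray t) \<Psi>'"
    and dim: "\<And>z. \<Psi> z \<in> carrier_mat k k" "T \<in> carrier_mat k k" and eq: "\<And>z. \<Psi>' z = \<Psi> z * T"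
    and ne: "lab u \<noteq> lab v" and nz: "T $$ (pos u, pos v) \<noteq> 0"
    and v: "l - int k < u + v + shift" "u + v + shift \<le> l"
  shows "u + v + shift = l \<and> sin (pi * of_int (u - v) / real k) < 0"
proof -
  define H where "H = u + v + shift"
  define c where "c = sin (pi * of_int (u - v) / real k)"
  have le: "c * sin (pi * (t - of_int H) / real k) \<le> 0" if "of_int l < t" "t < of_int l + real k" for t
    using connection_eq_0[OF norm(1)[OF that] norm(2)[OF that] dim eq ne] nz
    unfolding H_def c_def by (meson not_le)
  have "c \<noteq> 0" using ne unfolding c_def sin_pi_frac_eq_0_iff[OF k_pos] lab_eq_iff .
  have H: "real_of_int l - real k + 1 \<le> of_int H" "real_of_int H \<le> of_int l"
    using v unfolding H_def[symmetric] by linarith+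
  have "0 < sin (pi * (of_int l + 1 / 2 - of_int H) / real k)"
    by (rule sin_pi_frac_pos) (use H in linarith)+
  with le[of "of_int l + 1 / 2"] k_pos have "c \<le> 0" by (simp add: mult_le_0_iff)
  with \<open>c \<noteq> 0\<close> have "c < 0" by simp
  have "H = l"
  proof (rule ccontr)
    assume "H \<noteq> l"
    then have "real_of_int H \<le> of_int l - 1" using v unfolding H_def[symmetric] by linarith
    then have "0 < sin (pi * (of_int l - 1 / 2 - of_int H) / real k)"
      by (intro sin_pi_frac_pos) (use H in linarith)+
    moreover have "pi * (of_int l + real k - 1 / 2 - of_int H) / real k
        = pi * (of_int l - 1 / 2 - of_int H) / real k + pi"
      using k_pos by (simp add: field_simps)
    ultimately have "sin (pi * (of_int l + real k - 1 / 2 - of_int H) / real k) < 0" by simp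
    with le[of "of_int l + real k - 1 / 2"] k_pos \<open>c < 0\<close> show False by (simp add: mult_le_0_iff)
  qed
  then show ?thesis using \<open>c < 0\<close> by (simp add: H_def c_def)
qed

lemma normalized_Psi_Suc:
  assumes "of_int l < t" "t < of_int l + real k"
  shows "normalized_on_ray k g phi (ray t) (Psi l)" "normalized_on_ray k g phi (ray t) (Psi (l + 1))"
  by (rule normalized_Psi; use assms in simp)+

lemma S_diag: "S l $$ (pos u, pos u) = 1"
  using connection_matrix_diag[OF normalized_Psi_Suc[of l "of_int l + 1 / 2"] Psi_dim S_dim Psi_Suc pos_less]
    k_pos by simp

text \<open>The sectors of \<open>Psi l\<close> and \<open>Psi (l + 1)\<close> overlap in the window
  l < t < l + k. The conclusion says that the two labels exchange on the ray \<open>l\<close> and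
  that \<open>lab u\<close> is the more dominant one before.\<close>

lemma S_nonzero:
  assumes "lab u \<noteq> lab v" "S l $$ (pos u, pos v) \<noteq> 0" "l - int k < u + v + shift" "u + v + shift \<le> l"
  shows "u + v + shift = l \<and> sin (pi * of_int (u - v) / real k) < 0"
  by (rule connection_nonzero[OF normalized_Psi_Suc Psi_dim S_dim Psi_Suc assms])

lemma Psi_inj:
  assumes "v \<in> carrier_vec k" "w \<in> carrier_vec k" "\<And>z. Psi l z *\<^sub>v v = Psi l z *\<^sub>v w"
  shows "v = w"
  using normalized_on_ray_inj[OF normalized_Psi[of l "of_int l"] Psi_dim assms] k_pos by simp

lemma X_step: "X l = S l *\<^sub>v X (l + 1)"
proof (rule Psi_inj[OF X_dim])
  show "S l *\<^sub>v X (l + 1) \<in> carrier_vec k" using mult_mat_vec_carrier[OF S_dim X_dim] .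
  show "Psi l z *\<^sub>v X l = Psi l z *\<^sub>v (S l *\<^sub>v X (l + 1))" for z
    using psi_eq[of z l] psi_eq[of z "l + 1"] Psi_Suc[of l z]
      assoc_mult_mat_vec[OF Psi_dim S_dim X_dim, of l z l "l + 1"] by simp
qed

section \<open>Periodicity under a full turn\<close>

lemma Psi_connection: "\<exists>T \<in> carrier_mat k k. \<forall>z. Psi (l + int n) z = Psi l z * T"
proof (induction n)
  case 0
  have "Psi l z = Psi l z * 1\<^sub>m k" for z using Psi_dim[of l z] by simp
  then show ?case by (intro bexI[of _ "1\<^sub>m k"]) auto
next
  case (Suc n)
  then obtain T where T: "T \<in> carrier_mat k k" "\<And>z. Psi (l + int n) z = Psi l z * T" by blast
  have "Psi (l + int (Suc n)) z = Psi l z * (T * S (l + int n))" for z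
    using Psi_Suc[of "l + int n" z] assoc_mult_mat[OF Psi_dim T(1) S_dim, of l z "l + int n"]
    by (simp add: T(2) ac_simps)
  then show ?case using T(1) S_dim by (intro bexI[of _ "T * S (l + int n)"]) auto
qed

lemma normalized_Psi_turn:
  assumes "of_int l - 1 < t" "t < of_int l + real k"
  shows "normalized_on_ray k g phi (ray t) (Psi (l + int (2 * r * k)))"
proof -
  have "ray (t + 2 * real r * real k) = ray t + 2 * pi"
    using k_pos r_ge by (simp add: ray_def field_simps)
  then show ?thesis
    using normalized_Psi[of "l + int (2 * r * k)" "t + 2 * real r * real k"] assms
    by (simp add: normalized_on_ray_2pi)
qed

text \<open>Both solutions are normalized on the same sector. Its k + 1 segments contain two windows
  of k segments, and a nonzero off-diagonal entry would need both u + v + shift = l and u + v' +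
  shift = l - 1 with v, v' congruent modulo \<open>k\<close>.\<close>

lemma Psi_turn: "Psi (l + int (2 * r * k)) z = Psi l z"
proof -
  obtain T where T: "T \<in> carrier_mat k k" "\<And>z. Psi (l + int (2 * r * k)) z = Psi l z * T"
    using Psi_connection by blast
  have norm: "normalized_on_ray k g phi (ray t) (Psi l)"
      "normalized_on_ray k g phi (ray t) (Psi (l + int (2 * r * k)))"
    if "of_int l' < t" "t < of_int l' + real k" "l' = l \<or> l' = l - 1" for t l'
    using that by (intro normalized_Psi normalized_Psi_turn; auto)+
  have "T = 1\<^sub>m k"
  proof (rule eq_matI)
    fix i j assume "i < dim_row (1\<^sub>m k)" "j < dim_col (1\<^sub>m k)"
    then have ij: "i < k" "j < k" by auto
    obtain u where u: "i = pos u" using posE[OF ij(1)] by blast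
    show "T $$ (i, j) = 1\<^sub>m k $$ (i, j)"
    proof (cases "i = j")
      case True
      have "T $$ (j, j) = 1"
        by (rule connection_matrix_diag[OF norm[of l "of_int l + 1 / 2"] Psi_dim T ij(2)])
          (use k_pos in auto)
      then show ?thesis using True ij by simp
    next
      case False
      have "T $$ (i, j) = 0"
      proof (rule ccontr)
        assume nz: "T $$ (i, j) \<noteq> 0"
        have "\<exists>v. j = pos v \<and> u + v + shift = l'" if l': "l' = l \<or> l' = l - 1" for l'
        proof -
          obtain v where v: "j = pos v" "l' - shift - u - int k + 1 \<le> v" "v < l' - shift - u - int k + 1 + int k"
            using posE[OF ij(2)] by blast
          have "u + v + shift = l' \<and> sin (pi * of_int (u - v) / real k) < 0"
            by (rule connection_nonzero[OF norm(1)[OF _ _ l'] norm(2)[OF _ _ l'] Psi_dim T])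
              (use l' v u nz False pos_eq_iff[of u v] in auto)
          then show ?thesis using v by blast
        qed
        then obtain v v' where v: "j = pos v" "u + v + shift = l" "j = pos v'" "u + v' + shift = l - 1"
          by metis
        then have "int k dvd v - v'" using pos_eq_iff lab_eq_iff by blast
        moreover have "v - v' = 1" using v by linarith
        ultimately show False using False ij by auto
      qed
      then show ?thesis using False ij by simp
    qed
  qed (use T(1) in auto)
  then show ?thesis using T(2)[of z] Psi_dim[of l z] by simp
qed

lemma X_turn: "X (l + int (2 * r * k)) = X l"
proof (rule Psi_inj[OF X_dim X_dim])
  show "Psi l z *\<^sub>v X (l + int (2 * r * k)) = Psi l z *\<^sub>v X l" for z
    using psi_eq[of z l] psi_eq[of z "l + int (2 * r * k)"] unfolding Psi_turn by argo
qed

section \<open>Scalar relations between coefficients\<close>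

definition x :: "int \<Rightarrow> int \<Rightarrow> complex" where "x l u = component k (X l) (lab u)"

text \<open>The column is the only one, apart from the diagonal, in which row \<open>lab u\<close>
  of \<open>S l\<close> can be nonzero: its parameter v solves u + v + shift = l.\<close>

definition s :: "int \<Rightarrow> int \<Rightarrow> complex" where
  "s l u = entry k (S l) (lab u) (lab (l - shift - u))"

lemma x_sum: "x l u = (\<Sum>m<k. S l $$ (pos u, m) * vec_index (X (l + 1)) m)"
proof -
  have "x l u = vec_index (S l *\<^sub>v X (l + 1)) (pos u)"
    unfolding x_def component_lab using X_step[of l] by simp
  then show ?thesis
    using S_dim[of l] X_dim[of "l + 1"] pos_less[of u] by (simp add: scalar_prod_def atLeast0LessThan)
qed

lemma S_row_nonzero:
  assumes "m < k" "S l $$ (pos u, m) \<noteq> 0"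
  shows "m = pos u
    \<or> (m = pos (l - shift - u) \<and> sin (pi * of_int (2 * u + shift - l) / real k) < 0)"
proof (rule disjCI)
  assume "\<not> (m = pos (l - shift - u) \<and> sin (pi * of_int (2 * u + shift - l) / real k) < 0)"
  obtain v where v: "m = pos v" "l - shift - u - int k + 1 \<le> v" "v < l - shift - u - int k + 1 + int k"
    using posE[OF assms(1)] by blast
  show "m = pos u"
  proof (rule ccontr)
    assume "m \<noteq> pos u"
    then have "u + v + shift = l \<and> sin (pi * of_int (u - v) / real k) < 0"
      using v assms(2) pos_eq_iff[of u v] by (intro S_nonzero[of u v l]) auto
    then have "v = l - shift - u" "sin (pi * of_int (u - v) / real k) < 0" by auto
    then have "m = pos (l - shift - u) \<and> sin (pi * of_int (u - (l - shift - u)) / real k) < 0"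
      using v(1) by simp
    moreover have "u - (l - shift - u) = 2 * u + shift - l" by simp
    ultimately show False
      using \<open>\<not> (m = pos (l - shift - u) \<and> _)\<close> by simp
  qed
qed

text \<open>On the ray \<open>l\<close> the label either rises past its partner or coincides with
  it, so its row of \<open>S l\<close> is a unit row.\<close>

lemma x_step_const:
  assumes "0 \<le> sin (pi * of_int (2 * u + shift - l) / real k)"
  shows "x l u = x (l + 1) u"
proof -
  have "x l u = (\<Sum>m\<in>{pos u}. S l $$ (pos u, m) * vec_index (X (l + 1)) m)"
    unfolding x_sum
    by (rule sum.mono_neutral_right) (use pos_less S_row_nonzero[of _ l u] assms in force)+
  then show ?thesis by (simp add: S_diag x_def component_lab)
qed

lemma x_step:
  assumes "sin (pi * of_int (2 * u + shift - l) / real k) < 0"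
  shows "x l u = x (l + 1) u + s l u * x (l + 1) (l - shift - u)"
proof -
  have "\<not> int k dvd 2 * u + shift - l"
    using assms unfolding sin_pi_frac_eq_0_iff[OF k_pos, symmetric] by simp
  moreover have "u - (l - shift - u) = 2 * u + shift - l" by simp
  ultimately have "pos u \<noteq> pos (l - shift - u)" by (simp only: pos_eq_iff lab_eq_iff simp_thms)
  moreover have "x l u = (\<Sum>m\<in>{pos u, pos (l - shift - u)}. S l $$ (pos u, m) * vec_index (X (l + 1)) m)"
    unfolding x_sum
    by (rule sum.mono_neutral_right) (use pos_less S_row_nonzero[of _ l u] in force)+
  ultimately show ?thesis by (simp add: S_diag x_def s_def component_lab entry_lab)
qed

end

section \<open>Boundary condition and recursion\<close>

text \<open>The case n = m = 0, written as a ray of integral index. It shows that a cut exists, and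
  it is the direction used to compare two offsets.\<close>

lemma cut_direction_first:
  assumes "1 \<le> k" "1 \<le> r"
  shows "cut_direction k r eps a (pi * of_int (int r * (1 - int eps) + 2 * int a) / (real k * real r))"
  unfolding cut_direction_def
  by (intro exI[of _ 0] exI[of _ "0::int"]) (use assms in \<open>auto simp: field_simps\<close>)

context label_system
begin

lemma inj_on_lab: "b < a + int k \<Longrightarrow> inj_on lab {a..b}"
proof (rule inj_onI)
  fix u v assume "b < a + int k" "u \<in> {a..b}" "v \<in> {a..b}" "lab u = lab v"
  moreover from this have "\<not> int k \<le> \<bar>u - v\<bar>" by auto
  ultimately show "u = v"
    using lab_eq_iff[of u v] dvd_imp_le_int[of "u - v" "int k"] by auto
qed

text \<open>In row \<open>P - n\<close> exactly \<open>U - n + 1\<close>, ..., \<open>U - 1\<close>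
  lie above \<open>U - n\<close>, and \<open>U\<close> comes directly below it. The parameters of
  the pair and \<open>shift\<close> add up to \<open>P - n\<close>, so these are the labels in the
  definition of theta_n.\<close>

lemma profile_dominant_swap:
  assumes P: "P = 2 * U + shift" and n: "0 < n" "n < int k"
  shows "profile k r eps (P - n) (int k - n + 1) = lab (U - n)"
    and "profile k r eps (P - n) (int k - n) = lab U"
proof -
  let ?above = "\<lambda>u. {i \<in> {1..int k}. rank_key (P - n) (lab u) < rank_key (P - n) i}"
  have below: "rank_key (P - n) (lab (U - n)) < rank_key (P - n) (lab (U + v)) \<longleftrightarrow> - n < v \<and> v < 0"
    if v: "- n \<le> v" "v < - n + int k" for v
  proof -
    have "(P - n) - ((U + v) + (U - n) + shift) = - v" "(U + v) - (U - n) = v + n" by (simp_all add: P)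
    then have iff: "rank_key (P - n) (lab (U - n)) < rank_key (P - n) (lab (U + v)) \<longleftrightarrow>
        0 < sin (pi * of_int (v + n) / real k) * sin (pi * (of_int (- v) - 1 / 2) / real k)"
      by (simp only: rank_key_less_iff)
    have r: "- real_of_int n \<le> of_int v" "real_of_int v + of_int n + 1 \<le> real k"
      "0 < real_of_int n" "real_of_int n + 1 \<le> real k" using v n by linarith+
    consider "v = - n" | "- n < v" "v < 0" | "0 \<le> v" using v by linarith
    then show ?thesis
    proof cases
      case 2
      then have "real_of_int v \<le> -1" "- real_of_int n + 1 \<le> of_int v" by linarith+
      then have "0 < sin (pi * of_int (v + n) / real k)" "0 < sin (pi * (of_int (- v) - 1 / 2) / real k)"
        using r by (intro sin_pi_frac_pos; simp)+
      then show ?thesis using 2 unfolding iff by (simp only: mult_pos_pos simp_thms)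
    next
      case 3
      then have "0 < sin (pi * of_int (v + n) / real k)" using r
        by (intro sin_pi_frac_pos; simp)
      moreover have "sin (pi * (of_int (- v) - 1 / 2) / real k) < 0" using r 3
        by (intro sin_pi_frac_neg; simp)
      ultimately show ?thesis using 3 unfolding iff by (simp add: zero_less_mult_iff)
    qed (simp add: iff)
  qed
  have top: "rank_key (P - n) (lab U) < rank_key (P - n) (lab (U + v)) \<longleftrightarrow> v < 0"
    if v: "- n \<le> v" "v < - n + int k" for v
  proof -
    have "(P - n) - ((U + v) + U + shift) = - n - v" "(U + v) - U = v" by (simp_all add: P)
    then have iff: "rank_key (P - n) (lab U) < rank_key (P - n) (lab (U + v)) \<longleftrightarrow>
        0 < sin (pi * of_int v / real k) * sin (pi * (of_int (- n - v) - 1 / 2) / real k)"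
      by (simp only: rank_key_less_iff)
    have r: "- real_of_int n \<le> of_int v" "real_of_int v + of_int n + 1 \<le> real k"
      "0 < real_of_int n" "real_of_int n + 1 \<le> real k" using v n by linarith+
    have neg: "sin (pi * (of_int (- n - v) - 1 / 2) / real k) < 0" using r
      by (intro sin_pi_frac_neg; simp)
    have "0 < v \<Longrightarrow> 0 < sin (pi * of_int v / real k)" "v < 0 \<Longrightarrow> sin (pi * of_int v / real k) < 0"
      using r by (intro sin_pi_frac_pos sin_pi_frac_neg; simp)+
    then show ?thesis using neg unfolding iff by (cases v "0 :: int" rule: linorder_cases) (auto simp: zero_less_mult_iff)
  qed
  have reps: "\<exists>v. i = lab (U + v) \<and> - n \<le> v \<and> v < - n + int k" if i: "i \<in> {1..int k}" for i
  proof -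
    obtain w where "i = lab w" "U - n \<le> w" "w < U - n + int k" using labE[OF i] by blast
    then show ?thesis by (intro exI[of _ "w - U"]) auto
  qed
  have "?above (U - n) = lab ` {U - n + 1..U - 1}"
  proof (intro equalityI subsetI)
    fix i assume i: "i \<in> ?above (U - n)"
    then obtain v where v: "i = lab (U + v)" "- n \<le> v" "v < - n + int k" using reps by blast
    then have "- n < v \<and> v < 0" using below[OF v(2,3)] i by simp
    then show "i \<in> lab ` {U - n + 1..U - 1}" using v by (intro image_eqI[of _ _ "U + v"]) auto
  next
    fix i assume "i \<in> lab ` {U - n + 1..U - 1}"
    then obtain w where w: "i = lab w" "w \<in> {U - n + 1..U - 1}" by blast
    then have "rank_key (P - n) (lab (U - n)) < rank_key (P - n) (lab (U + (w - U)))"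
      using n by (subst below) auto
    then show "i \<in> ?above (U - n)" using w lab_range by simp
  qed
  then have "int (card (?above (U - n))) = n - 1"
    using n by (simp add: card_image inj_on_lab)
  then show "profile k r eps (P - n) (int k - n + 1) = lab (U - n)"
    by (intro profile_eqI lab_range) simp
  have "?above U = lab ` {U - n..U - 1}"
  proof (intro equalityI subsetI)
    fix i assume i: "i \<in> ?above U"
    then obtain v where v: "i = lab (U + v)" "- n \<le> v" "v < - n + int k" using reps by blast
    then have "v < 0" using top[OF v(2,3)] i by simp
    then show "i \<in> lab ` {U - n..U - 1}" using v by (intro image_eqI[of _ _ "U + v"]) auto
  next
    fix i assume "i \<in> lab ` {U - n..U - 1}"
    then obtain w where w: "i = lab w" "w \<in> {U - n..U - 1}" by blast
    then have "rank_key (P - n) (lab U) < rank_key (P - n) (lab (U + (w - U)))"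
      using n by (subst top) auto
    then show "i \<in> ?above U" using w lab_range by simp
  qed
  then have "int (card (?above U)) = n"
    using n by (simp add: card_image inj_on_lab)
  then show "profile k r eps (P - n) (int k - n) = lab U"
    by (intro profile_eqI lab_range) simp
qed

end

locale multicut = stokes_data +
  fixes a :: nat
  assumes multicut: "multicut_condition k r eps m1 a X"
begin

definition P :: "int \<Rightarrow> int" where "P N = twice_s r eps a N"

text \<open>This is s - eps gamma / 2 for 2s = \<open>P N\<close>; it is integral because eps r -
  eps (r - 2) = 2 eps.\<close>

definition U :: "int \<Rightarrow> int" where "U N = int r * N + int a + int eps"

lemma P_U: "P N = 2 * U N + shift"
  by (simp add: P_def U_def twice_s_def shift_def algebra_simps)

lemma U_add: "U (N + m) = U N + int r * m"
  by (simp add: U_def algebra_simps)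

lemma P_add: "P (N + m) = P N + 2 * int r * m"
  by (simp add: P_U U_add)

lemma dominant_index_P: "dominant_index k r eps m1 (P N) = lab (U N)"
  by (simp add: dominant_index_def lab_def shift_def[symmetric] P_U)

lemma dominant_in_segment_P:
  assumes "P N - int r + 1 \<le> p" "p \<le> P N + int r"
  shows "dominant_in_segment k r eps X p (lab (U N))"
proof -
  have "P N = 2 * int r * N + twice_s r eps a 0" by (simp add: P_def twice_s_def algebra_simps)
  then show ?thesis
    using multicut assms unfolding multicut_condition_def Let_def dominant_index_P[symmetric] by simp
qed

lemma x_dominant_nonzero:
  assumes "P N - int r + 1 \<le> p" "p \<le> P N + int r" "l \<le> p" "p \<le> l + int k"
  shows "x l (U N) \<noteq> 0"
  using dominant_in_segment_P[OF assms(1,2)] assms(3,4) by (simp add: dominant_in_segment_def x_def)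

lemma x_eq_0:
  assumes "P N - int r + 1 \<le> p" "p \<le> P N + int r" "l \<le> p" "p \<le> l + int k"
    and "0 < sin (pi * of_int d / real k) * sin (pi * (of_int (p - P N - d) - 1 / 2) / real k)"
  shows "x l (U N + d) = 0"
proof -
  have "p - (U N + d + U N + shift) = p - P N - d" "U N + d - U N = d" by (simp_all add: P_U)
  then have "more_dominant k r eps p (lab (U N + d)) (lab (U N))"
    using assms(5) by (intro more_dominant_labI) (simp only:)
  then show ?thesis
    using dominant_in_segment_P[OF assms(1,2)] assms(3,4) lab_range[of "U N + d"]
    by (simp add: dominant_in_segment_def x_def)
qed

text \<open>Of two dominant labels, the higher one would have a component at \<open>l = p\<close>
  that is both zero and nonzero.\<close>

lemma dominant_in_segment_unique:
  assumes "dominant_in_segment k r eps X p d" "dominant_in_segment k r eps X p d'"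
  shows "d = d'"
proof -
  have *: "\<not> rank_key p i < rank_key p j"
    if "dominant_in_segment k r eps X p i" "dominant_in_segment k r eps X p j" for i j
  proof
    assume "rank_key p i < rank_key p j"
    then have "more_dominant k r eps p j i"
      using that by (intro more_dominantI) (auto simp: dominant_in_segment_def)
    then have "component k (X p) j = 0" "component k (X p) j \<noteq> 0"
      using that unfolding dominant_in_segment_def by auto
    then show False by simp
  qed
  have "rank_key p d = rank_key p d'" using *[OF assms] *[OF assms(2,1)] by simp
  then show ?thesis
    using assms inj_rank_key[of p] by (auto simp: dominant_in_segment_def inj_on_def)
qed

text \<open>Otherwise all \<open>U N\<close> name one label, which is then dominant in every
  segment, although the cut condition demands a change.\<close>

lemma not_k_dvd_r: "\<not> int k dvd int r"
proof
  assume dvd: "int k dvd int r"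
  define p where "p = int r * (1 - int eps) + 2 * int a"
  have "1 \<le> r" using r_ge by simp
  then have "\<exists>d d'. dominant_in_segment k r eps X p d \<and> dominant_in_segment k r eps X (p + 1) d' \<and> d \<noteq> d'"
    using multicut cut_direction_first[OF k_pos] unfolding multicut_condition_def Let_def p_def by blast
  moreover have "dominant_in_segment k r eps X p' (lab (U 0))" for p'
  proof -
    \<comment> \<open>The blocks of 2r segments around the rows \<open>P N\<close> tile the
      integers; \<open>N\<close> is the block containing \<open>p'\<close>.\<close>
    define N where "N = (p' - P 0 + int r - 1) div (2 * int r)"
    have "p' - P 0 + int r - 1 = 2 * int r * N + (p' - P 0 + int r - 1) mod (2 * int r)"
      by (simp add: N_def)
    moreover have "0 \<le> (p' - P 0 + int r - 1) mod (2 * int r)"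
        "(p' - P 0 + int r - 1) mod (2 * int r) < 2 * int r" using r_ge by auto
    ultimately have "P N - int r + 1 \<le> p'" "p' \<le> P N + int r"
      using P_add[of 0 N] by auto
    then have "dominant_in_segment k r eps X p' (lab (U N))" by (rule dominant_in_segment_P)
    moreover have "lab (U N) = lab (U 0)"
      using dvd U_add[of 0 N] by (simp add: lab_eq_iff)
    ultimately show ?thesis by simp
  qed
  ultimately show False using dominant_in_segment_unique by blast
qed

text \<open>If r >= k, then r mod 2k lies strictly between k and 2k and sin(pi r / k) < 0. So in the
  last segment of block 0 the label \<open>U 1\<close> is already above \<open>U 0\<close> and its
  component vanishes; but the sector starting at that segment also meets block 1, where it must not
  vanish.\<close>

lemma r_less_k:
  assumes "\<not> (2 * k < r \<and> 0 < r mod (2 * k) \<and> r mod (2 * k) < k)"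
  shows "r < k"
proof (rule ccontr)
  assume "\<not> r < k"
  define m where "m = r mod (2 * k)"
  have r: "r = 2 * k * (r div (2 * k)) + m" by (simp add: m_def)
  have kr: "\<not> k dvd r" using not_k_dvd_r by simp
  have "k dvd r" if "k dvd m"
    by (subst r) (intro dvd_add that dvd_mult2 dvd_triv_right)
  then have "m \<noteq> 0" "m \<noteq> k" using kr by (metis dvd_0_right, metis dvd_refl)
  moreover have "r \<noteq> 2 * k" "r \<noteq> k" using kr by auto
  moreover have "m < 2 * k" using k_pos by (simp add: m_def)
  moreover have "r < 2 * k \<Longrightarrow> m = r" by (simp add: m_def)
  ultimately have m: "k < m" "m < 2 * k"
    using assms \<open>\<not> r < k\<close> unfolding m_def[symmetric] by (auto simp: not_less)
  have "pi * real r / real k = pi * (real m - real k) / real k + pi + 2 * pi * real (r div (2 * k))"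
    using k_pos arg_cong[OF r, of real] by (simp add: field_simps)
  moreover have "sin (y + 2 * pi * real n) = sin y" for y n
    using sin_add[of y "2 * pi * real n"] by (simp add: sin_integer_2pi cos_integer_2pi)
  ultimately have "sin (pi * real r / real k) = - sin (pi * (real m - real k) / real k)" by simp
  also have "\<dots> < 0" using sin_pi_frac_pos[of "real m - real k" k] m by simp
  finally have "sin (pi * real r / real k) < 0" .
  moreover have "sin (pi * (- (1 / 2)) / real k) < 0" by (rule sin_pi_frac_neg) (use k_pos in auto)
  ultimately have "0 < sin (pi * real r / real k) * sin (pi * (- (1 / 2)) / real k)"
    by (rule mult_neg_neg)
  then have "x (P 0 + int r) (U 0 + int r) = 0"
    by (intro x_eq_0[of 0 "P 0 + int r"]) (use r_ge in auto)
  moreover have "x (P 0 + int r) (U 1) \<noteq> 0"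
    by (rule x_dominant_nonzero[of 1 "P 0 + int r + 1"]) (use P_add[of 0 1] k_pos r_ge in auto)
  ultimately show False using U_add[of 0 1] by simp
qed

end

lemma constant_on_int_interval:
  fixes f :: "int \<Rightarrow> 'a"
  assumes "\<And>l. A \<le> l \<Longrightarrow> l < B \<Longrightarrow> f l = f (l + 1)" "A \<le> i" "i \<le> B" "A \<le> j" "j \<le> B"
  shows "f i = f j"
proof -
  have "i \<le> B \<longrightarrow> f i = f A" if "A \<le> i" for i
    using that by (induction rule: int_ge_induct) (use assms(1) in force)+
  then show ?thesis using assms(2-) by metis
qed

context multicut
begin

definition dominant_x :: "int \<Rightarrow> complex" where "dominant_x N = x (P N) (U N)"

text \<open>Offset and index enter only through their sum: all sequences of one solution are
  translates of one.\<close>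

lemma y_seq_eq: "y_seq k r eps m1 X (P q) n = dominant_x (q + n)"
proof -
  have "2 * int r * n + P q = P (q + n)" by (simp add: P_add)
  then show ?thesis by (simp add: y_seq_def dominant_x_def x_def dominant_index_P)
qed

lemma dominant_x_nonzero: "dominant_x N \<noteq> 0"
  unfolding dominant_x_def by (rule x_dominant_nonzero[of N "P N"]) (use r_ge in auto)

lemma dominant_x_periodic: "dominant_x (N + int k * c) = dominant_x N"
proof -
  have step: "dominant_x (N + int k) = dominant_x N" for N
  proof -
    have "P (N + int k) = P N + int (2 * r * k)" by (simp add: P_add)
    moreover have "lab (U (N + int k)) = lab (U N)" by (simp add: U_add lab_eq_iff)
    ultimately show ?thesis by (simp only: dominant_x_def x_def X_turn)
  qed
  have nat: "dominant_x (N + int k * int n) = dominant_x N" for N n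
    by (induction n) (use step in \<open>simp_all add: algebra_simps, metis add.assoc add.commute\<close>)
  show ?thesis
  proof (cases "0 \<le> c")
    case True
    then show ?thesis using nat[of N "nat c"] by simp
  next
    case False
    then show ?thesis using nat[of "N + int k * c" "nat (- c)"] by simp
  qed
qed

lemma x_lab_cong: "int k dvd u - v \<Longrightarrow> x l u = x l v"
  using lab_eq_iff[of u v] by (simp add: x_def)

lemma theta_P:
  assumes "0 < n" "n < int k"
  shows "theta k r eps S (P N - 2 * int r) n = s (P N - n) (U N - n)"
proof -
  have L: "2 * int r + (P N - 2 * int r) - n = P N - n" by simp
  have partner: "P N - n - shift - (U N - n) = U N" by (simp add: P_U)
  show ?thesis
    using assms unfolding s_def partner
    by (simp add: theta_def L Let_def profile_dominant_swap[OF P_U assms])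
qed

end

locale multicut_small = multicut +
  assumes r_k: "r < k"
begin

text \<open>The label \<open>U N + d\<close> passes \<open>U N\<close> on the ray
  \<open>P N + d\<close> and stays above it for the rest of block \<open>N\<close>.\<close>

lemma x_ahead_eq_0:
  assumes "0 < d" "d < int r" "P N + d + 1 - int k \<le> l" "l \<le> P N + int r"
  shows "x l (U N + d) = 0"
proof (rule x_eq_0)
  \<comment> \<open>The first segment of the sector lying past the exchange;
    \<open>d < int r\<close> keeps it inside block \<open>N\<close>.\<close>
  define p where "p = max l (P N + d + 1)"
  show "P N - int r + 1 \<le> p" "p \<le> P N + int r" "l \<le> p" "p \<le> l + int k"
    using assms r_k by (auto simp: p_def)
  have "d + 1 \<le> p - P N" "p - P N - d < int k" using assms r_k by (auto simp: p_def)
  then have "1 \<le> real_of_int (p - P N - d)" "real_of_int (p - P N - d) < real k" by linarith+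
  moreover have "0 < real_of_int d" "real_of_int d < real k" using assms r_k by linarith+
  ultimately show "0 < sin (pi * of_int d / real k) * sin (pi * (of_int (p - P N - d) - 1 / 2) / real k)"
    by (intro mult_pos_pos sin_pi_frac_pos) linarith+
qed

text \<open>Segment \<open>P N - d\<close> is the last one before \<open>U N - d\<close> drops below
  \<open>U N\<close>.\<close>

lemma x_behind_eq_0:
  assumes "0 < d" "d < int r"
  shows "x (P N - d) (U N - d) = 0"
proof -
  have "sin (pi * of_int (- d) / real k) < 0" "sin (pi * (of_int (P N - d - P N - (- d)) - 1 / 2) / real k) < 0"
    using assms r_k by (intro sin_pi_frac_neg; linarith)+
  then have "x (P N - d) (U N + (- d)) = 0"
    by (intro x_eq_0[of N "P N - d"]) (use assms in \<open>auto simp: mult_neg_neg\<close>)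
  then show ?thesis by simp
qed

text \<open>Up to row \<open>P N\<close> no Stokes term arises. Later the labels passing
  \<open>U N\<close> are \<open>U N + d\<close> with 0 < d < r, whose components vanish.\<close>

lemma x_dominant_const:
  assumes "P N - int k \<le> l" "l \<le> P N + int r"
  shows "x l (U N) = dominant_x N"
  unfolding dominant_x_def
proof (rule constant_on_int_interval[where A = "P N - int k" and B = "P N + int r"])
  fix l assume l: "P N - int k \<le> l" "l < P N + int r"
  have arg: "2 * U N + shift - l = P N - l" by (simp add: P_U)
  show "x l (U N) = x (l + 1) (U N)"
  proof (cases "l \<le> P N")
    case True
    then consider "P N - l = 0" | "0 < P N - l" "P N - l < int k" | "P N - l = int k"
      using l by linarith
    then have "0 \<le> sin (pi * of_int (P N - l) / real k)"
    proof cases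
      case 2
      then have "0 < real_of_int (P N - l)" "real_of_int (P N - l) < real k" by linarith+
      then show ?thesis by (intro less_imp_le sin_pi_frac_pos)
    qed (use k_pos in simp_all)
    then show ?thesis by (intro x_step_const) (simp only: arg)
  next
    case False
    then have "sin (pi * of_int (P N - l) / real k) < 0"
      by (intro sin_pi_frac_neg) (use l r_k in linarith)+
    moreover have "x (l + 1) (U N + (l - P N)) = 0"
      by (rule x_ahead_eq_0) (use False l in auto)
    moreover have "l - shift - U N = U N + (l - P N)" by (simp add: P_U)
    ultimately show ?thesis using x_step[of "U N" l] by (simp only: arg) simp
  qed
qed (use assms in auto)

text \<open>The component \<open>U M - b\<close> is followed while it descends from the top to the bottom of the profile;
  it picks up a Stokes contribution from each label it crosses.\<close>

lemma x_telescope: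
  assumes "0 < b" "b + int n \<le> int k"
  shows "x (P M - b) (U M - b)
    = (\<Sum>t<n. s (P M - b + int t) (U M - b) * x (P M - b + int t + 1) (U M + int t))
      + x (P M - b + int n) (U M - b)"
  using assms(2)
proof (induction n)
  case (Suc n)
  have arg: "2 * (U M - b) + shift - (P M - b + int n) = - b - int n" by (simp add: P_U)
  have "sin (pi * of_int (- b - int n) / real k) < 0"
    by (rule sin_pi_frac_neg) (use Suc.prems assms(1) in linarith)+
  then have "x (P M - b + int n) (U M - b) = x (P M - b + int n + 1) (U M - b)
      + s (P M - b + int n) (U M - b) * x (P M - b + int n + 1) (P M - b + int n - shift - (U M - b))"
    by (intro x_step) (simp only: arg)
  moreover have "P M - b + int n - shift - (U M - b) = U M + int n" by (simp add: P_U)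
  ultimately have "x (P M - b + int n) (U M - b) = x (P M - b + int n + 1) (U M - b)
      + s (P M - b + int n) (U M - b) * x (P M - b + int n + 1) (U M + int n)" by (simp only:)
  then show ?case using Suc by (simp add: ac_simps)
qed simp

text \<open>At step r m the crossed label is the dominant one of block \<open>M + m\<close>, and the
  row is \<open>P (M + m)\<close> minus the theta index b + r m.\<close>

lemma crossing_term:
  assumes "0 < b" "0 \<le> m" "b + int r * m < int k"
  shows "s (P M - b + int r * m) (U M - b) * x (P M - b + int r * m + 1) (U M + int r * m)
    = theta k r eps S (P (M + m) - 2 * int r) (b + int r * m) * dominant_x (M + m)"
proof -
  have "0 \<le> int r * m" using assms(2) by simp
  moreover have "P (M + m) = P M + 2 * (int r * m)" by (simp add: P_add)
  ultimately have "x (P M - b + int r * m + 1) (U (M + m)) = dominant_x (M + m)"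
    by (intro x_dominant_const) (use assms r_ge in linarith)+
  moreover have "theta k r eps S (P (M + m) - 2 * int r) (b + int r * m)
      = s (P (M + m) - (b + int r * m)) (U (M + m) - (b + int r * m))"
    by (rule theta_P) (use assms in \<open>auto simp: add_pos_nonneg\<close>)
  ultimately show ?thesis by (simp add: P_add U_add algebra_simps)
qed

text \<open>Between multiples of \<open>r\<close> the crossed label lies strictly ahead of a
  dominant one.\<close>

lemma non_crossing_term:
  assumes "0 < b" "0 \<le> t" "b + t < int k" "\<not> int r dvd t"
  shows "x (P M - b + t + 1) (U M + t) = 0"
proof -
  define m d where "m = t div int r" and "d = t mod int r"
  have t: "t = int r * m + d" by (simp add: m_def d_def)
  have d: "0 < d" "d < int r"
    using assms(4) r_ge pos_mod_sign[of "int r" t] pos_mod_bound[of "int r" t]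
    unfolding d_def dvd_eq_mod_eq_0 by linarith+
  have "0 \<le> m" using assms(2) r_ge by (simp add: m_def pos_imp_zdiv_nonneg_iff)
  then have "0 \<le> int r * m" by simp
  moreover have "P (M + m) = P M + 2 * (int r * m)" by (simp add: P_add)
  ultimately have "x (P M - b + t + 1) (U (M + m) + d) = 0"
    by (intro x_ahead_eq_0) (use d t assms in linarith)+
  then show ?thesis by (simp add: U_add t ac_simps)
qed

text \<open>Source of the theta_0 term: for \<open>b = int r\<close> the label is the dominant one
  of block \<open>M - 1\<close>, taken at that block's last row.\<close>

lemma start_term:
  assumes "1 \<le> b" "b \<le> int r"
  shows "x (P M - b) (U M - b) = (if b = int r then dominant_x (M - 1) else 0)"
proof (cases "b = int r")
  case True
  have "P M - b = P (M - 1) + int r" "U M - b = U (M - 1)"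
    using P_add[of "M - 1" 1] U_add[of "M - 1" 1] True by auto
  then show ?thesis using x_dominant_const[of "M - 1" "P M - b"] True r_k by simp
next
  case False
  then show ?thesis using x_behind_eq_0[of b M] assms by simp
qed

text \<open>Source of the theta_k term. After k - b steps from row \<open>P M - b\<close>, the label
  is read modulo \<open>k\<close> as \<open>U M + k - b\<close>, which is ahead of a later dominant
  label or equal to it.\<close>

lemma end_term:
  assumes "1 \<le> b" "b \<le> int r"
  shows "x (P M + int k - 2 * b) (U M - b)
    = (if int r dvd int k - b then dominant_x (M + (int k - b) div int r) else 0)"
proof -
  define m d where "m = (int k - b) div int r" and "d = (int k - b) mod int r"
  have kb: "int k - b = int r * m + d" by (simp add: m_def d_def)
  have d: "0 \<le> d" "d < int r" using r_ge by (auto simp: d_def)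
  have "U (M + m) + d - (U M - b) = int k" using kb by (simp add: U_add)
  then have cong: "x l (U M - b) = x l (U (M + m) + d)" for l
    by (intro x_lab_cong) (metis dvd_minus_iff dvd_refl minus_diff_eq)
  have l: "P M + int k - 2 * b = P (M + m) + 2 * d - int k" using kb by (simp add: P_add)
  show ?thesis
  proof (cases "int r dvd int k - b")
    case True
    then have "d = 0" by (simp add: d_def)
    then show ?thesis using True x_dominant_const[of "M + m"] by (simp add: cong l m_def[symmetric])
  next
    case False
    then have "0 < d" using d unfolding d_def dvd_eq_mod_eq_0 by linarith
    then show ?thesis using False x_ahead_eq_0[of d "M + m"] d r_k by (simp add: cong l)
  qed
qed

lemma recursion:
  assumes b: "1 \<le> b" "b \<le> int r"
  shows "recursion_F k r eps S (P q) b (y_seq k r eps m1 X (P q)) = 0"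
proof -
  \<comment> \<open>The theta index of the summand \<open>n\<close>. The indices 0 and k, where
    theta is set by convention, are split off from the true Stokes entries.\<close>
  define v where "v n = int r * (n - 1) + b" for n
  define f where "f n = theta k r eps S (P (q + n) - 2 * int r) (v n) * dominant_x (q + n)" for n
  define D where "D A = {n. v n \<in> A}" for A
  have r0: "0 < int r" using r_ge by simp
  have inj: "inj v" using r0 by (auto simp: v_def inj_on_def)
  have fin: "finite (D A)" if "finite A" for A
    unfolding D_def using finite_vimageI[OF that inj] by (simp add: vimage_def)
  have "2 * int r * (n - 1) + P q = P (q + n) - 2 * int r" for n
    unfolding P_add by (simp add: algebra_simps)
  then have "recursion_F k r eps S (P q) b (y_seq k r eps m1 X (P q)) = sum f (D {0..int k})"
    unfolding recursion_F_def f_def v_def D_def y_seq_eq by simp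
  also have "D {0..int k} = D {0} \<union> (D {0<..<int k} \<union> D {int k})"
    using k_pos by (auto simp: D_def)
  also have "sum f \<dots> = sum f (D {0}) + (sum f (D {0<..<int k}) + sum f (D {int k}))"
  proof -
    have "D {0} \<inter> (D {0<..<int k} \<union> D {int k}) = {}" "D {0<..<int k} \<inter> D {int k} = {}"
      using k_pos by (auto simp: D_def)
    then show ?thesis by (simp add: sum.union_disjoint fin)
  qed
  also have "sum f (D {0}) = - x (P (q + 1) - b) (U (q + 1) - b)"
  proof (cases "b = int r")
    case True
    have "D {0} = {0}" using r0 by (auto simp: D_def v_def True right_diff_distrib)
    then show ?thesis using start_term[OF b, of "q + 1"] True by (simp add: f_def v_def theta_def)
  next
    case False
    have "v n \<noteq> 0" for n
    proof
      assume "v n = 0"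
      then have "int r dvd b" by (metis v_def add.commute dvd_add_right_iff dvd_0_right dvd_triv_left)
      then show False using False b zdvd_imp_le[of "int r" b] by auto
    qed
    then show ?thesis using False by (simp add: start_term[OF b] D_def)
  qed
  also have "sum f (D {int k}) = x (P (q + 1) + int k - 2 * b) (U (q + 1) - b)"
  proof (cases "int r dvd int k - b")
    case True
    then obtain m where m: "int k - b = int r * m" by blast
    have "v (m + 1) = int r * m + b" by (simp add: v_def)
    then have vm: "v (m + 1) = int k" "(int k - b) div int r = m" using m r0 by simp_all
    have "n = m + 1" if "v n = int k" for n
      using injD[OF inj, of n "m + 1"] that vm(1) by simp
    then have "D {int k} = {m + 1}" using vm(1) unfolding D_def by blast
    moreover have "f (m + 1) = dominant_x (q + 1 + m)"
      unfolding f_def vm(1) using k_pos by (simp add: theta_def ac_simps)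
    ultimately show ?thesis using end_term[OF b, of "q + 1"] True vm(2) by simp
  next
    case False
    have "int k - b = int r * (n - 1)" if "v n = int k" for n using that unfolding v_def by simp
    then have "v n \<noteq> int k" for n using False by (metis dvd_triv_left)
    then show ?thesis using False by (simp add: end_term[OF b] D_def)
  qed
  also have "sum f (D {0<..<int k}) = (\<Sum>t<nat (int k - b). s (P (q + 1) - b + int t) (U (q + 1) - b)
      * x (P (q + 1) - b + int t + 1) (U (q + 1) + int t))" (is "_ = sum ?h _")
  proof -
    have "?h t = 0" if "t < nat (int k - b)" "\<not> int r dvd int t" for t
      using non_crossing_term[of b "int t" "q + 1"] that b by simp
    then have "\<forall>t\<in>{..<nat (int k - b)} - {t \<in> {..<nat (int k - b)}. int r dvd int t}. ?h t = 0"
      by blast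
    then have "sum ?h {..<nat (int k - b)} = sum ?h {t \<in> {..<nat (int k - b)}. int r dvd int t}"
      by (intro sum.mono_neutral_right) auto
    also have "\<dots> = sum f (D {0<..<int k})"
    \<comment> \<open>The substitution t = r (n - 1) matches a summand of the recursion with a
      crossing of a dominant label.\<close>
    proof (rule sum.reindex_bij_witness[of _ "\<lambda>n. nat (int r * (n - 1))" "\<lambda>t. int t div int r + 1"])
      fix t assume t: "t \<in> {t \<in> {..<nat (int k - b)}. int r dvd int t}"
      then have "int r dvd int t" "int t < int k - b" by auto
      then obtain m where m: "int t = int r * m" "int r * m < int k - b" by (metis dvdE)
      have m0: "0 \<le> m" using r0 m(1) by (metis of_nat_0_le_iff zero_le_mult_iff not_le)
      have div: "int t div int r = m" using m(1) r0 by simp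
      show "nat (int r * (int t div int r + 1 - 1)) = t" 
        unfolding div using m(1) by (metis add_diff_cancel_right' nat_int)
      have lt: "b + int r * m < int k" using m(2) by simp
      show "int t div int r + 1 \<in> D {0<..<int k}"
        using lt b m0 by (simp add: div D_def v_def add_nonneg_pos)
      show "f (int t div int r + 1) = ?h t"
        using crossing_term[of b m "q + 1"] lt m0 b unfolding div m(1) f_def v_def by (simp add: ac_simps)
    next
      fix n assume "n \<in> D {0<..<int k}"
      then have v: "0 < v n" "v n < int k" by (auto simp: D_def)
      have "0 < n"
      proof (rule ccontr)
        assume "\<not> 0 < n"
        then have "int r * (n - 1) \<le> int r * (- 1)" by (intro mult_left_mono) auto
        then show False using v b by (simp add: v_def)
      qed
      then have "0 \<le> int r * (n - 1)" by simp
      then have nat: "int (nat (int r * (n - 1))) = int r * (n - 1)" by simp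
      then have "int r dvd int (nat (int r * (n - 1)))" by (simp only: dvd_triv_left)
      moreover have "nat (int r * (n - 1)) < nat (int k - b)"
        unfolding zless_nat_eq_int_zless nat using v(2) by (simp add: v_def)
      ultimately show "nat (int r * (n - 1)) \<in> {t \<in> {..<nat (int k - b)}. int r dvd int t}"
        by blast
      show "int (nat (int r * (n - 1))) div int r + 1 = n" unfolding nat using r0 by simp
    qed
    finally show ?thesis by simp
  qed
  finally show ?thesis
    using x_telescope[of b "nat (int k - b)" "q + 1"] b r_k by (simp add: algebra_simps)
qed

end

text \<open>The first cut direction for \<open>a\<close> is also one for \<open>a'\<close>. In units
  of pi / (k r) this is an equation of integers that gives a = a' modulo r.\<close>

lemma multicut_offset_unique:
  assumes "1 \<le> k" "3 \<le> r" "a < r" "a' < r"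
    and "multicut_condition k r eps m1 a X" "multicut_condition k r eps m1 a' X"
  shows "a' = a"
proof -
  define p where "p = int r * (1 - int eps) + 2 * int a"
  have "cut_direction k r eps a (pi * of_int p / (real k * real r))"
    unfolding p_def by (rule cut_direction_first) (use assms(1,2) in auto)
  then have "cut_direction k r eps a' (pi * of_int p / (real k * real r))"
    using assms(5,6) unfolding multicut_condition_def Let_def by blast
  then obtain n :: nat and m :: int where "pi * of_int p / (real k * real r) = pi / real k * (1 - real eps)
      + 2 * pi * real a' / (real r * real k) + 2 * pi * real n / real k + 2 * pi * of_int m"
    unfolding cut_direction_def by blast
  also have "\<dots> = pi * (real r * (1 - real eps) + 2 * real a' + 2 * real r * real n
      + 2 * real r * real k * of_int m) / (real k * real r)"
    using assms(1,2) by (simp add: field_simps)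
  finally have "of_int p = real r * (1 - real eps) + 2 * real a' + 2 * real r * real n
      + 2 * real r * real k * of_int m" using assms(1,2) by simp
  also have "\<dots> = of_int (int r * (1 - int eps) + 2 * int a' + 2 * int r * int n + 2 * int r * int k * m)"
    by simp
  finally have "p = int r * (1 - int eps) + 2 * int a' + 2 * int r * int n + 2 * int r * int k * m"
    using of_int_eq_iff by blast
  then have "int a = int a' + int r * (int n + int k * m)" by (simp add: p_def algebra_simps)
  then have "int a mod int r = int a' mod int r" by simp
  then show ?thesis using assms(3,4) by simp
qed

theorem theorem1:
  fixes k r eps a :: nat and m1 :: int and g :: real
    and Q :: "complex poly mat" and phi :: "int \<Rightarrow> complex poly" and Y :: "complex fps mat"
    and Psi :: "int \<Rightarrow> complex \<Rightarrow> complex mat" and S :: "int \<Rightarrow> complex mat"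
    and psi :: "complex \<Rightarrow> complex vec" and X :: "int \<Rightarrow> complex vec"
  assumes "1 \<le> k" and "3 \<le> r" and "coprime k (r - 2)" and "eps \<in> {0, 1}"
    and "[(int r - 2) * m1 = 1] (mod int k)"
    and non_degenerate: "\<not> (2 * k < r \<and> 0 < r mod (2 * k) \<and> r mod (2 * k) < k)"
    and "0 < g" and "system_matrix k r eps Q"
    and "exponents k r eps phi" and "formal_solution k r g Q phi Y"
    and "\<And>l. canonical_solution k r g Q phi Y l (Psi l)"
    and "stokes_matrices k Psi S"
    and "vector_solution k g Q psi"
    and "\<And>l. X l \<in> carrier_vec k" and "\<And>l z. psi z = Psi l z *\<^sub>v X l"
    and "a < r" and "multicut_condition k r eps m1 a X"
  shows
    "(\<forall>q\<in>{0..int k - 1}. \<forall>b\<in>{1..int r}.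
        recursion_F k r eps S (twice_s r eps a q) b (y_seq k r eps m1 X (twice_s r eps a q)) = 0) \<and>
     (\<forall>q n. y_seq k r eps m1 X (twice_s r eps a q) n \<noteq> 0) \<and>
     (\<forall>q n c. y_seq k r eps m1 X (twice_s r eps a q) n =
              y_seq k r eps m1 X (twice_s r eps a q + 2 * int r * c) (n - c)) \<and>
     (\<forall>q n. y_seq k r eps m1 X (twice_s r eps a q) n =
            y_seq k r eps m1 X (twice_s r eps a q) (n + int k)) \<and>
     (\<forall>q n. y_seq k r eps m1 X (twice_s r eps a q) n =
            y_seq k r eps m1 X (twice_s r eps a 0) (wrap k (n + q))) \<and>
     (\<forall>a'<r. multicut_condition k r eps m1 a' X \<longrightarrow> a' = a)"
proof -
  interpret multicut k r eps m1 g Q phi Y Psi S psi X a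
    by unfold_locales (use assms in auto)
  interpret multicut_small k r eps m1 g Q phi Y Psi S psi X a
    by unfold_locales (rule r_less_k[OF non_degenerate])
  have F: "recursion_F k r eps S (P q) b (y_seq k r eps m1 X (P q)) = 0" if "b \<in> {1..int r}" for q b
    using recursion that by simp
  have shift: "y_seq k r eps m1 X (P q) n = y_seq k r eps m1 X (P q + 2 * int r * c) (n - c)" for q n c
    by (simp add: y_seq_def algebra_simps)
  have period: "dominant_x (q + n) = dominant_x (q + (n + int k))" for q n
    using dominant_x_periodic[of "q + n" 1] by (simp add: ac_simps)
  \<comment> \<open>Each \<open>q\<close> only re-indexes the sequence for q = 0, so one offset
    \<open>a\<close> yields one sequence of length \<open>k\<close>.\<close>
  have wrap: "dominant_x (q + n) = dominant_x (0 + wrap k (n + q))" for q n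
  proof -
    define c where "c = (n + q - 1) div int k"
    have "n + q - 1 = int k * c + (n + q - 1) mod int k" by (simp add: c_def)
    then have "wrap k (n + q) + int k * c = q + n" unfolding wrap_def by linarith
    then show ?thesis using dominant_x_periodic[of "wrap k (n + q)" c] by simp
  qed
  have unique: "a' = a" if "a' < r" "multicut_condition k r eps m1 a' X" for a'
    using multicut_offset_unique[OF k_pos r_ge \<open>a < r\<close> that(1) multicut that(2)] .
  show ?thesis
    unfolding P_def[symmetric] using F shift period wrap unique
    by (auto simp: y_seq_eq dominant_x_nonzero)
qed

end
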